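(* For every fixed integer $r\ge 3$ we have $$W(r,k)=\Omega\bigl(k^{r-1}/(\log k)^{r-2}\bigr)\qquad\text{as } k\to\infty,$$ where the implicit constant may depend on $r$.
   Context: For integers $r,k\ge 2$, the van der Waerden number $W(r,k)$ is the smallest integer $n$ such that every coloring of $[n]=\{1,\dots,n\}$ with the two colors red and blue contains either a red $r$-term arithmetic progression or a blue $k$-term arithmetic progression. *)

theory Defs
  imports Complex_Main "HOL-Library.Landau_Symbols"
begin

datatype colour = Red | Blue

text \<open>
  The common difference is required to be positive, so the \<open>m\<close> terms are distinct. A colouring is a
  total function on the naturals; only its values on \<open>{1..n}\<close> are ever inspected.
\<close>

definition has_mono_AP :: "nat \<Rightarrow> (nat \<Rightarrow> colour) \<Rightarrow> colour \<Rightarrow> nat \<Rightarrow> bool" where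
  "has_mono_AP n \<chi> c m \<longleftrightarrow>
     (\<exists>a d. d > 0 \<and> (\<forall>i<m. a + i * d \<in> {1..n} \<and> \<chi> (a + i * d) = c))"

text \<open>
  By van der Waerden's theorem some \<open>n\<close> with the required property always exists, so the
  \<open>LEAST\<close> is a genuine minimum.
\<close>

definition vdW :: "nat \<Rightarrow> nat \<Rightarrow> nat" where
  "vdW r k = (LEAST n. \<forall>\<chi> :: nat \<Rightarrow> colour. has_mono_AP n \<chi> Red r \<or> has_mono_AP n \<chi> Blue k)"

end

theory Submission
  imports Defs "HOL-Library.FuncSet" "HOL-Computational_Algebra.Primes"
begin

text \<open>
  Let \<open>m\<close> be a prime between \<open>2 k\<^sup>r\<^sup>-\<^sup>2\<close> and \<open>k\<^sup>r\<^sup>-\<^sup>2\<close> times a small power of \<open>k\<close>, and \<open>n = m (k - 1)\<close>.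
  A progression of \<open>k\<close> terms below \<open>n\<close> has difference below \<open>m\<close>, so its terms lie in distinct
  residue classes modulo \<open>m\<close>. Inside each residue
  class of a random set \<open>L\<close> of classes we colour red a random translate of a fixed 3-AP-free set
  \<open>F \<subseteq> {0..<k - 1}\<close> of quotients. If \<open>L\<close> contains no \<open>r\<close>-term progression modulo \<open>m\<close>, there is no red
  one at all: its terms would share a residue class, and their quotients would form a progression in
  \<open>F\<close>. A Behrend-type choice of \<open>F\<close>, of density \<open>k\<close> to a small negative power, allows \<open>L\<close> to be so
  sparse that deleting a few classes destroys all its progressions, while every progression of \<open>k\<close>
  terms is still hit. This even gives \<open>vdW r k > k\<^sup>r\<^sup>-\<^sup>1\<close> for large \<open>k\<close>. Since \<open>vdW\<close> is a \<open>LEAST\<close>,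
  a lower bound also requires van der Waerden's theorem, which is proved by colour focusing.
\<close>

section \<open>Van der Waerden's theorem\<close>

definition mono_run :: "(nat \<Rightarrow> nat) \<Rightarrow> nat \<Rightarrow> nat \<Rightarrow> nat \<Rightarrow> nat \<Rightarrow> bool" where
  "mono_run \<chi> col k a d \<longleftrightarrow> d > 0 \<and> (\<forall>i<k. \<chi> (a + i * d) = col)"

text \<open>All runs share the same continuation \<open>f\<close>, whose own colour is left open: if
  that colour lies in \<open>C\<close>, one of the runs gains a term.\<close>

definition focused :: "(nat \<Rightarrow> nat) \<Rightarrow> nat \<Rightarrow> nat \<Rightarrow> nat set \<Rightarrow> bool" where
  "focused \<chi> k f C \<longleftrightarrow> (\<forall>col\<in>C. \<exists>a d. a + k * d = f \<and> mono_run \<chi> col k a d)"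

text \<open>The run itself has \<open>k\<close> terms; its continuation \<open>a + k * d\<close> is also required to lie below \<open>N\<close>.\<close>

definition vdW_bound :: "nat \<Rightarrow> nat \<Rightarrow> nat \<Rightarrow> bool" where
  "vdW_bound k c N \<longleftrightarrow>
     (\<forall>\<chi>. (\<forall>x. \<chi> x < c) \<longrightarrow> (\<exists>a d col. a + k * d < N \<and> mono_run \<chi> col k a d))"

lemma mono_run_Suc: "mono_run \<chi> col (Suc k) a d \<longleftrightarrow> mono_run \<chi> col k a d \<and> \<chi> (a + k * d) = col"
  by (auto simp: mono_run_def less_Suc_eq)

lemma mono_run_shift:
  "mono_run (\<lambda>x. \<chi> (b + x)) col k a d \<longleftrightarrow> mono_run \<chi> col k (b + a) d"
  by (simp add: mono_run_def add.assoc)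

text \<open>Only the values below \<open>N\<close> matter, and there are finitely many such
  patterns. Numbering them turns the pattern of a block into a single colour, so that the induction
  hypothesis applies to the colouring of blocks.\<close>

lemma block_coding:
  fixes c N :: nat
  shows "\<exists>(M :: nat) \<phi>. (\<forall>u. (\<forall>x :: nat. u x < c) \<longrightarrow> \<phi> u < M) \<and>
    (\<forall>u v. (\<forall>x. u x < c) \<and> (\<forall>x. v x < c) \<and> \<phi> u = \<phi> v \<longrightarrow> (\<forall>x<N. u x = v x))"
proof -
  define K where "K = ({..<N} \<rightarrow>\<^sub>E {..<c})"
  have "finite K" unfolding K_def by (intro finite_PiE) auto
  then obtain h where h: "bij_betw h K {0..<card K}" using ex_bij_betw_finite_nat by blast
  have inK: "restrict u {..<N} \<in> K" if "\<forall>x. u x < c" for u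
    using that by (auto simp: K_def)
  have "h (restrict u {..<N}) < card K" if "\<forall>x. u x < c" for u
    using bij_betwE[OF h] inK[OF that] by auto
  moreover have "\<forall>x<N. u x = v x"
    if u: "\<forall>x. u x < c" and v: "\<forall>x. v x < c" and eq: "h (restrict u {..<N}) = h (restrict v {..<N})" for u v
  proof -
    have "restrict u {..<N} = restrict v {..<N}"
      by (rule inj_onD[OF bij_betw_imp_inj_on[OF h] eq inK[OF u] inK[OF v]])
    then show ?thesis by (metis lessThan_iff restrict_apply')
  qed
  ultimately show ?thesis
    by (intro exI[of _ "card K"] exI[of _ "\<lambda>u. h (restrict u {..<N})"]) blast
qed

text \<open>Blocks of length \<open>N\<close> are coloured by their patterns, and the hypothesis for
  \<open>k\<close> yields \<open>k\<close> identical blocks in progression. Adding the block step to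
  the differences of the \<open>s\<close> focused runs moves their focus into the next block. The
  copies of the old focus form one further run, whose colour is new because otherwise a run of
  \<open>k + 1\<close> terms would exist.\<close>

lemma focused_step:
  assumes k: "k > 0" and IH: "\<And>c. \<exists>N. vdW_bound k c N"
    and N: "\<And>\<chi>. (\<forall>x. \<chi> x < c) \<Longrightarrow>
      (\<exists>a d col. a + k * d < N \<and> mono_run \<chi> col (Suc k) a d) \<or>
      (\<exists>f C. f < N \<and> C \<subseteq> {..<c} \<and> card C = s \<and> focused \<chi> k f C)"
  shows "\<exists>N'. \<forall>\<chi>. (\<forall>x. \<chi> x < c) \<longrightarrow>
      (\<exists>a d col. a + k * d < N' \<and> mono_run \<chi> col (Suc k) a d) \<or>
      (\<exists>f C. f < N' \<and> C \<subseteq> {..<c} \<and> card C = Suc s \<and> focused \<chi> k f C)"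
proof -
  obtain M :: nat and \<phi> where \<phi>: "\<forall>u. (\<forall>x :: nat. u x < c) \<longrightarrow> \<phi> u < M"
    and \<phi>_eq: "\<forall>u v. (\<forall>x. u x < c) \<and> (\<forall>x. v x < c) \<and> \<phi> u = \<phi> v \<longrightarrow> (\<forall>x<N. u x = v x)"
    using block_coding[of c N] by blast
  obtain L where L: "vdW_bound k M L" using IH by blast
  have "(\<exists>a d col. a + k * d < L * N \<and> mono_run \<chi> col (Suc k) a d) \<or>
      (\<exists>f C. f < L * N \<and> C \<subseteq> {..<c} \<and> card C = Suc s \<and> focused \<chi> k f C)"
    if \<chi>: "\<forall>x. \<chi> x < c" for \<chi>
  proof (cases "\<exists>a d col. a + k * d < L * N \<and> mono_run \<chi> col (Suc k) a d")
    case no_run: False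
    define \<psi> where "\<psi> A = \<phi> (\<lambda>x. \<chi> (A * N + x))" for A
    have "\<forall>A. \<psi> A < M" unfolding \<psi>_def using \<phi> \<chi> by simp
    then obtain A D col where AD: "A + k * D < L" "mono_run \<psi> col k A D"
      using L unfolding vdW_bound_def by blast
    have D: "D > 0" using AD(2) by (simp add: mono_run_def)
    have same: "\<chi> ((A + i * D) * N + x) = \<chi> (A * N + x)" if "i < k" "x < N" for i x
    proof -
      have "\<psi> (A + i * D) = col" "\<psi> (A + 0 * D) = col"
        using AD(2) that k unfolding mono_run_def by blast+
      then have "\<phi> (\<lambda>x. \<chi> ((A + i * D) * N + x)) = \<phi> (\<lambda>x. \<chi> (A * N + x))"
        by (simp add: \<psi>_def)
      then have "\<forall>x<N. \<chi> ((A + i * D) * N + x) = \<chi> (A * N + x)"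
        using \<phi>_eq[rule_format, of "\<lambda>x. \<chi> ((A + i * D) * N + x)" "\<lambda>x. \<chi> (A * N + x)"] \<chi> by blast
      then show ?thesis using that(2) by blast
    qed
    have inL: "(A + k * D) * N + x < L * N" if "x < N" for x
    proof -
      have "(A + k * D) * N + x < Suc (A + k * D) * N" using that by simp
      also have "\<dots> \<le> L * N" using AD(1) by (intro mult_le_mono1) simp
      finally show ?thesis .
    qed
    have inL0: "A * N + x < L * N" if "x < N" for x
      using inL[OF that] by (simp add: algebra_simps)
    define \<xi> where "\<xi> = (\<lambda>x. \<chi> (A * N + x))"
    have "\<forall>x. \<xi> x < c" using \<chi> by (simp add: \<xi>_def)
    from N[OF this] have "\<exists>f C. f < N \<and> C \<subseteq> {..<c} \<and> card C = s \<and> focused \<xi> k f C"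
    proof (elim disjE exE conjE)
      fix a d col assume "a + k * d < N" "mono_run \<xi> col (Suc k) a d"
      then have "A * N + a + k * d < L * N" "mono_run \<chi> col (Suc k) (A * N + a) d"
        using inL0[of "a + k * d"] mono_run_shift[of \<chi> "A * N" col "Suc k" a d] by (auto simp: \<xi>_def)
      then show ?thesis using no_run by blast
    qed blast
    then obtain f C where f: "f < N" and C: "C \<subseteq> {..<c}" "card C = s" and foc: "focused \<xi> k f C"
      by blast
    have new: "\<xi> f \<notin> C"
    proof
      assume "\<xi> f \<in> C"
      then obtain a d where ad: "a + k * d = f" "mono_run \<xi> (\<xi> f) k a d"
        using foc unfolding focused_def by blast
      then have "mono_run \<xi> (\<xi> f) (Suc k) a d" by (simp add: mono_run_Suc)
      then have "mono_run \<chi> (\<xi> f) (Suc k) (A * N + a) d"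
        using mono_run_shift[of \<chi> "A * N" "\<xi> f" "Suc k" a d] by (simp add: \<xi>_def)
      moreover have "A * N + a + k * d < L * N" using inL0[OF f] ad(1) by simp
      ultimately show False using no_run by blast
    qed
    have run: "mono_run \<chi> col k (A * N + a) (d + D * N)"
      if ad: "a + k * d = f" and col: "\<And>i. i < k \<Longrightarrow> \<xi> (a + i * d) = col"
        and pos: "d + D * N > 0" for a d col
    proof -
      have "\<chi> (A * N + a + i * (d + D * N)) = col" if i: "i < k" for i
      proof -
        have "i * d \<le> k * d" using i by (intro mult_le_mono1) simp
        then have lt: "a + i * d < N" using ad f by linarith
        have eq: "A * N + a + i * (d + D * N) = (A + i * D) * N + (a + i * d)"
          by (simp add: algebra_simps)
        show ?thesis unfolding eq using same[OF i lt] col[OF i] by (simp add: \<xi>_def)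
      qed
      then show ?thesis using pos by (simp add: mono_run_def)
    qed
    have DN: "D * N > 0" using D f by simp
    have "focused \<chi> k ((A + k * D) * N + f) (insert (\<xi> f) C)"
      unfolding focused_def
    proof
      fix col assume "col \<in> insert (\<xi> f) C"
      then have "\<exists>a d. a + k * d = f \<and> (\<forall>i<k. \<xi> (a + i * d) = col)"
      proof
        assume "col = \<xi> f"
        then show ?thesis by (intro exI[of _ f] exI[of _ 0]) auto
      next
        assume "col \<in> C"
        then show ?thesis using foc unfolding focused_def mono_run_def by blast
      qed
      then obtain a d where ad: "a + k * d = f" "\<forall>i<k. \<xi> (a + i * d) = col" by blast
      have "mono_run \<chi> col k (A * N + a) (d + D * N)" using run ad DN by auto
      moreover have "A * N + a + k * (d + D * N) = (A + k * D) * N + f"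
        using ad(1) by (simp add: algebra_simps)
      ultimately show "\<exists>a d. a + k * d = (A + k * D) * N + f \<and> mono_run \<chi> col k a d" by blast
    qed
    moreover have "card (insert (\<xi> f) C) = Suc s"
      using new C finite_subset[OF C(1)] by simp
    moreover have "insert (\<xi> f) C \<subseteq> {..<c}" using C(1) \<chi> by (auto simp: \<xi>_def)
    ultimately show ?thesis using inL[OF f] by blast
  qed blast
  then show ?thesis by blast
qed

lemma vdW_bound_exists: "\<exists>N. vdW_bound k c N"
proof (induction k arbitrary: c)
  case 0
  show ?case by (intro exI[of _ 1]) (auto simp: vdW_bound_def mono_run_def intro: exI[of _ "1::nat"])
next
  case (Suc k)
  show ?case
  proof (cases "k = 0")
    case True
    have "vdW_bound 1 c 2" unfolding vdW_bound_def mono_run_def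
      by (intro allI impI, rule exI[of _ 0], rule exI[of _ 1]) simp
    then show ?thesis using True by auto
  next
    case False
    have "\<exists>N. \<forall>\<chi>. (\<forall>x. \<chi> x < c) \<longrightarrow>
      (\<exists>a d col. a + k * d < N \<and> mono_run \<chi> col (Suc k) a d) \<or>
      (\<exists>f C. f < N \<and> C \<subseteq> {..<c} \<and> card C = s \<and> focused \<chi> k f C)" for s
    proof (induction s)
      case 0
      show ?case by (intro exI[of _ 1]) (auto simp: focused_def)
    next
      case (Suc s)
      then obtain N where "\<forall>\<chi>. (\<forall>x. \<chi> x < c) \<longrightarrow>
        (\<exists>a d col. a + k * d < N \<and> mono_run \<chi> col (Suc k) a d) \<or>
        (\<exists>f C. f < N \<and> C \<subseteq> {..<c} \<and> card C = s \<and> focused \<chi> k f C)" by blast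
      with focused_step[of k c N s] False \<open>\<And>c. \<exists>N. vdW_bound k c N\<close> show ?case by blast
    qed
    \<comment> \<open>There are only \<open>c\<close> colours, so asking for \<open>c + 1\<close>
      focused ones leaves the long run as the only alternative.\<close>
    from this[of "Suc c"] obtain N where N: "\<forall>\<chi>. (\<forall>x. \<chi> x < c) \<longrightarrow>
      (\<exists>a d col. a + k * d < N \<and> mono_run \<chi> col (Suc k) a d) \<or>
      (\<exists>f C. f < N \<and> C \<subseteq> {..<c} \<and> card C = Suc c \<and> focused \<chi> k f C)" by blast
    \<comment> \<open>Doubling makes room for the continuation of the longer run, since
      \<open>d \<le> k * d < N\<close>.\<close>
    have "vdW_bound (Suc k) c (2 * N)"
      unfolding vdW_bound_def
    proof (intro allI impI)
      fix \<chi> :: "nat \<Rightarrow> nat" assume \<chi>: "\<forall>x. \<chi> x < c"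
      have "\<not> (C \<subseteq> {..<c} \<and> card C = Suc c)" for C
        using card_mono[of "{..<c}" C] by auto
      then obtain a d col where ad: "a + k * d < N" "mono_run \<chi> col (Suc k) a d"
        using N \<chi> by blast
      have "d \<le> k * d" using False by simp
      then have "a + Suc k * d < 2 * N" using ad(1) unfolding mult_Suc by linarith
      with ad(2) show "\<exists>a d col. a + Suc k * d < 2 * N \<and> mono_run \<chi> col (Suc k) a d" by blast
    qed
    then show ?thesis by blast
  qed
qed

section \<open>Existence of the van der Waerden number\<close>

lemma has_mono_AP_mono: "\<lbrakk>has_mono_AP n \<chi> c k; n \<le> n'\<rbrakk> \<Longrightarrow> has_mono_AP n' \<chi> c k"
  unfolding has_mono_AP_def by (meson atLeastAtMost_iff order_trans)

lemma has_mono_AP_length_mono: "\<lbrakk>has_mono_AP n \<chi> c k; k' \<le> k\<rbrakk> \<Longrightarrow> has_mono_AP n \<chi> c k'"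
  unfolding has_mono_AP_def by (meson order_less_le_trans)

text \<open>A run of length \<open>max r k\<close> serves either colour. The colouring is shifted by
  one because runs start at 0 and progressions at 1.\<close>

lemma vdW_exists: "\<exists>n. \<forall>\<chi>. has_mono_AP n \<chi> Red r \<or> has_mono_AP n \<chi> Blue k"
proof -
  obtain N where N: "vdW_bound (max r k) 2 N" using vdW_bound_exists by blast
  have "has_mono_AP N \<chi> Red r \<or> has_mono_AP N \<chi> Blue k" for \<chi>
  proof -
    define \<xi> where "\<xi> x = (case \<chi> (Suc x) of Red \<Rightarrow> 0 | Blue \<Rightarrow> (1 :: nat))" for x
    have "\<forall>x. \<xi> x < 2" by (simp add: \<xi>_def split: colour.split)
    then obtain a d col where ad: "a + max r k * d < N" "mono_run \<xi> col (max r k) a d"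
      using N unfolding vdW_bound_def by blast
    have "Suc a + i * d \<in> {1..N}" if "i < max r k" for i
    proof -
      have "i * d \<le> max r k * d" using that by (intro mult_le_mono1) simp
      then have "Suc a + i * d \<le> N" using ad(1) by linarith
      then show ?thesis by simp
    qed
    moreover have "\<xi> (a + i * d) = col" if "i < max r k" for i
      using ad(2) that by (simp add: mono_run_def)
    then have "\<chi> (Suc a + i * d) = (if col = 0 then Red else Blue)" if "i < max r k" for i
      using that by (cases "\<chi> (Suc a + i * d)") (force simp: \<xi>_def)+
    moreover have "d > 0" using ad(2) by (simp add: mono_run_def)
    ultimately have "has_mono_AP N \<chi> (if col = 0 then Red else Blue) (max r k)"
      unfolding has_mono_AP_def by blast
    then show ?thesis using has_mono_AP_length_mono[of N \<chi> _ "max r k"]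
      by (auto split: if_splits)
  qed
  then show ?thesis by blast
qed

lemma vdW_gt:
  assumes "\<not> has_mono_AP n \<chi> Red r" "\<not> has_mono_AP n \<chi> Blue k"
  shows "vdW r k > n"
proof (rule ccontr)
  assume "\<not> vdW r k > n"
  moreover have "has_mono_AP (vdW r k) \<chi> Red r \<or> has_mono_AP (vdW r k) \<chi> Blue k"
    using LeastI_ex[OF vdW_exists[of r k]] unfolding vdW_def by blast
  ultimately show False using has_mono_AP_mono assms by (meson not_le)
qed

section \<open>Primes in intervals\<close>

text \<open>Legendre's formula: passing from \<open>n\<close> to \<open>Suc n\<close> raises the
  quotient by \<open>p ^ i\<close> exactly when \<open>p ^ i\<close> divides \<open>Suc n\<close>.
  The cutoff \<open>M\<close> lies beyond all such exponents.\<close>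

lemma multiplicity_fact_Legendre:
  fixes p :: nat
  assumes p: "prime p" and M: "n < p ^ M"
  shows "multiplicity p (fact n :: nat) = (\<Sum>i=1..M. n div p ^ i)"
  using M
proof (induction n)
  case 0
  then show ?case by simp
next
  case (Suc n)
  have p1: "p > 1" using p prime_gt_1_nat by blast
  have "multiplicity p (fact (Suc n) :: nat) = multiplicity p (Suc n) + multiplicity p (fact n :: nat)"
    using p by (simp add: prime_elem_multiplicity_mult_distrib del: mult_Suc)
  also have "multiplicity p (Suc n) = card {i\<in>{1..M}. p ^ i dvd Suc n}"
  proof -
    have "i \<le> M" if "p ^ i dvd Suc n" for i
    proof -
      have "p ^ i < p ^ M" using dvd_imp_le[OF that] Suc.prems by simp
      then show ?thesis using p1 power_less_imp_less_exp[of p i M] by simp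
    qed
    then have "{i\<in>{1..M}. p ^ i dvd Suc n} = {1..multiplicity p (Suc n)}"
      using p1 by (auto simp: power_dvd_iff_le_multiplicity)
    then show ?thesis by simp
  qed
  also have "\<dots> = (\<Sum>i=1..M. if p ^ i dvd Suc n then 1 else 0)"
    by (simp add: sum.If_cases Int_def)
  also have "\<dots> + multiplicity p (fact n :: nat) = (\<Sum>i=1..M. Suc n div p ^ i)"
    using Suc by (auto simp: sum.distrib[symmetric] div_Suc dvd_eq_mod_eq_0 intro!: sum.cong)
  finally show ?case .
qed

text \<open>By Legendre's formula each power \<open>p ^ i \<le> 2 * n\<close> contributes at most 1
  to the multiplicity, and larger powers contribute nothing.\<close>

lemma prime_power_multiplicity_central_binomial_le:
  fixes p :: nat
  assumes p: "prime p" and n: "n > 0"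
  shows "p ^ multiplicity p ((2 * n) choose n) \<le> 2 * n"
proof -
  have p1: "p > 1" using p prime_gt_1_nat by blast
  define L where "L = card {i\<in>{1..2*n}. p ^ i \<le> 2 * n}"
  have M: "2 * n < p ^ (2 * n)"
    using p1 n by (meson le_less_trans less_exp order_refl power_mono prime_ge_2_nat p less_le_trans zero_le)
  have "(fact (2 * n) :: nat) = fact n * fact n * ((2 * n) choose n)"
    using binomial_fact_lemma[of n "2 * n"] by (simp add: mult_2)
  then have "multiplicity p (fact (2 * n) :: nat) = 2 * multiplicity p (fact n :: nat) + multiplicity p ((2 * n) choose n)"
    using p by (simp add: prime_elem_multiplicity_mult_distrib)
  then have "multiplicity p ((2 * n) choose n) = (\<Sum>i=1..2*n. 2 * n div p ^ i) - 2 * (\<Sum>i=1..2*n. n div p ^ i)"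
    using multiplicity_fact_Legendre[OF p M] multiplicity_fact_Legendre[OF p, of n "2 * n"] M by simp
  also have "\<dots> \<le> (\<Sum>i=1..2*n. if p ^ i \<le> 2 * n then 1 else 0)"
  proof -
    have "2 * n div q \<le> 2 * (n div q) + (if q \<le> 2 * n then 1 else 0)" for q
    proof (cases "q \<le> 2 * n \<and> q > 0")
      case True
      have "n < q + q * (n div q)" using True by (intro dividend_less_times_div) simp
      then have "2 * n < 2 * (q + q * (n div q))" by simp
      also have "\<dots> = (2 * (n div q) + 2) * q" by (simp add: algebra_simps)
      finally have "2 * n < (2 * (n div q) + 2) * q" .
      then have "2 * n div q < 2 * (n div q) + 2" by (simp add: True less_mult_imp_div_less)
      then show ?thesis using True by simp
    qed auto
    then have "(\<Sum>i=1..2*n. 2 * n div p ^ i) \<le> (\<Sum>i=1..2*n. 2 * (n div p ^ i) + (if p ^ i \<le> 2 * n then 1 else 0))"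
      by (intro sum_mono) auto
    then show ?thesis by (simp add: sum.distrib sum_distrib_left)
  qed
  also have "\<dots> = L" by (simp add: sum.If_cases Int_def L_def)
  finally have le: "multiplicity p ((2 * n) choose n) \<le> L" .
  show ?thesis
  \<comment> \<open>If \<open>p ^ L\<close> exceeded \<open>2 * n\<close>, the exponents counted by
    \<open>L\<close> would all lie in \<open>{1..<L}\<close>, which is one too few unless
    \<open>L = 0\<close>.\<close>
  proof (rule ccontr)
    assume "\<not> ?thesis"
    then have gt: "2 * n < p ^ L" using le p1 by (meson not_le less_le_trans power_increasing less_imp_le)
    then have "i < L" if "p ^ i \<le> 2 * n" for i
      using that p1 power_less_imp_less_exp[of p i L] by linarith
    then have "{i\<in>{1..2*n}. p ^ i \<le> 2 * n} \<subseteq> {1..<L}" by auto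
    then have "L \<le> L - 1" unfolding L_def[symmetric] using card_mono[of "{1..<L}"] L_def by fastforce
    then have "L = 0" by simp
    with gt n show False by simp
  qed
qed

text \<open>A Chebyshev-type argument: all prime factors of the central binomial coefficient are at
  most \<open>2 * n\<close>. If none exceeded \<open>x\<close>, there would be at most
  \<open>x\<close> of them, each contributing a factor at most \<open>2 * n\<close>, while the
  coefficient is at least \<open>2 ^ n\<close>.\<close>

lemma prime_between:
  fixes x n :: nat
  assumes n: "n > 0" and gt: "(2 * n) ^ x < 2 ^ n"
  obtains p where "prime p" "x < p" "p \<le> 2 * n"
proof -
  let ?c = "(2 * n) choose n"
  have "\<exists>p. prime p \<and> x < p \<and> p \<le> 2 * n"
  proof (rule ccontr)
    assume no: "\<nexists>p. prime p \<and> x < p \<and> p \<le> 2 * n"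
    have c0: "?c > 0" by simp
    have sub: "prime_factors ?c \<subseteq> {1..x}"
    proof
      fix p assume "p \<in> prime_factors ?c"
      then have p: "prime p" "p dvd ?c" by auto
      have "p dvd fact (2 * n)"
        using p(2) binomial_fact_lemma[of n "2 * n"] by (metis dvd_mult le_add1 mult_2)
      then have "p \<le> 2 * n" using p(1) prime_dvd_fact_iff by blast
      with no p(1) show "p \<in> {1..x}" using prime_gt_0_nat[OF p(1)] by (auto simp: not_less Suc_le_eq)
    qed
    have "?c = (\<Prod>p\<in>prime_factors ?c. p ^ multiplicity p ?c)"
      using prime_factorization_nat[of ?c] c0 by simp
    also have "\<dots> \<le> (\<Prod>p\<in>prime_factors ?c. 2 * n)"
      by (intro prod_mono) (use prime_power_multiplicity_central_binomial_le n in auto)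
    also have "\<dots> = (2 * n) ^ card (prime_factors ?c)" by simp
    also have "\<dots> \<le> (2 * n) ^ x"
      using card_mono[OF _ sub] n by (intro power_increasing) auto
    also have "\<dots> < 2 ^ n" by (rule gt)
    also have "\<dots> \<le> ?c"
    proof -
      have "(real (2 * n) / real n) ^ n \<le> real ?c"
        by (rule binomial_ge_n_over_k_pow_k) simp
      moreover have "real (2 * n) / real n = 2" using n by simp
      ultimately have "2 ^ n \<le> real ?c" by simp
      then show ?thesis by (metis of_nat_le_iff of_nat_numeral of_nat_power)
    qed
    finally show False by simp
  qed
  then show thesis using that by blast
qed

section \<open>Dense sets without three-term progressions\<close>

definition three_AP_free :: "nat set \<Rightarrow> bool" where
  "three_AP_free F \<longleftrightarrow> (\<forall>x d. d > 0 \<longrightarrow> \<not> (x \<in> F \<and> x + d \<in> F \<and> x + 2 * d \<in> F))"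

text \<open>Strict convexity of squaring: with \<open>e\<close> the distance from \<open>v\<close>
  to either end, the two sides differ by \<open>2 * e\<^sup>2\<close>.\<close>

lemma square_midpoint_nat:
  fixes u v w :: nat
  assumes "u + w = 2 * v"
  shows "u\<^sup>2 + w\<^sup>2 \<ge> 2 * v\<^sup>2" "u\<^sup>2 + w\<^sup>2 = 2 * v\<^sup>2 \<longleftrightarrow> u = w"
proof -
  obtain e where e: "v = u + e \<and> w = u + 2 * e \<or> v = w + e \<and> u = w + 2 * e"
  proof (cases "u \<le> w")
    case True
    then show ?thesis using that[of "v - u"] assms by linarith
  next
    case False
    then show ?thesis using that[of "v - w"] assms by linarith
  qed
  then have key: "u\<^sup>2 + w\<^sup>2 = 2 * v\<^sup>2 + 2 * e\<^sup>2"
    by (elim disjE conjE) (simp_all add: power2_sum power_mult_distrib)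
  then show "u\<^sup>2 + w\<^sup>2 \<ge> 2 * v\<^sup>2" by simp
  show "u\<^sup>2 + w\<^sup>2 = 2 * v\<^sup>2 \<longleftrightarrow> u = w" unfolding key using e by auto
qed

text \<open>This is strict convexity in midpoint form. It is what keeps level sets of
  \<open>f\<close> free of three-term progressions.\<close>

definition midpoint_convex_on :: "nat set \<Rightarrow> (nat \<Rightarrow> nat) \<Rightarrow> bool" where
  "midpoint_convex_on X f \<longleftrightarrow> (\<forall>x\<in>X. \<forall>y\<in>X. \<forall>w\<in>X. x + w = 2 * y \<longrightarrow>
     2 * f y \<le> f x + f w \<and> (f x + f w = 2 * f y \<longrightarrow> x = w))"

text \<open>\<open>X\<close> consists of the numbers with \<open>D\<close> digits below \<open>z\<close> in base \<open>2z\<close> (so that no carries occur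
  in \<open>x + w = 2y\<close>), and \<open>f\<close> is the sum of the squared digits.\<close>

lemma midpoint_convex_digit_function:
  assumes z: "z > 0"
  shows "\<exists>X f. X \<subseteq> {..<(2 * z) ^ D} \<and> card X = z ^ D \<and> (\<forall>x\<in>X. f x \<le> D * z\<^sup>2) \<and>
    midpoint_convex_on X f"
proof (induction D)
  case 0
  show ?case
    by (rule exI[of _ "{0}"], rule exI[of _ "\<lambda>_. 0"]) (simp add: midpoint_convex_on_def)
next
  case (Suc D)
  then obtain X f where X: "X \<subseteq> {..<(2 * z) ^ D}" and card: "card X = z ^ D"
    and f: "\<forall>x\<in>X. f x \<le> D * z\<^sup>2"
    and conv: "midpoint_convex_on X f"
    by blast
  \<comment> \<open>\<open>e\<close> appends \<open>u\<close> as a new lowest digit in base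
    \<open>2 * z\<close>.\<close>
  define e where "e = (\<lambda>(x, u). u + 2 * z * x)"
  define Y where "Y = e ` (X \<times> {..<z})"
  define g where "g y = f (y div (2 * z)) + (y mod (2 * z))\<^sup>2" for y
  have inj: "inj_on e (X \<times> {..<z})"
  proof (rule inj_onI, clarsimp simp: e_def)
    fix x u x' u' assume u: "u < z" "u' < z" and eq: "u + 2 * z * x = u' + 2 * z * x'"
    have "(u + 2 * z * x) mod (2 * z) = u" "(u' + 2 * z * x') mod (2 * z) = u'" using u by simp_all
    then have "u = u'" unfolding eq by simp
    with eq z show "x = x' \<and> u = u'" by simp
  qed
  have e_div: "e (x, u) div (2 * z) = x" and e_mod: "e (x, u) mod (2 * z) = u" if "u < z" for x u
    using that by (simp_all add: e_def)
  have "Y \<subseteq> {..<(2 * z) ^ Suc D}"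
  proof
    fix y assume "y \<in> Y"
    then obtain x u where xu: "x \<in> X" "u < z" "y = u + 2 * z * x" by (auto simp: Y_def e_def)
    have "y < 2 * z * Suc x" using xu by simp
    also have "\<dots> \<le> 2 * z * (2 * z) ^ D" using xu(1) X by (intro mult_le_mono2) auto
    finally show "y \<in> {..<(2 * z) ^ Suc D}" by simp
  qed
  moreover have "card Y = z ^ Suc D"
    unfolding Y_def card_image[OF inj] using card by (simp add: card_cartesian_product)
  moreover have "\<forall>y\<in>Y. g y \<le> Suc D * z\<^sup>2"
  proof
    fix y assume "y \<in> Y"
    then obtain x u where xu: "x \<in> X" "u < z" "y = e (x, u)" by (auto simp: Y_def)
    have "u\<^sup>2 \<le> z\<^sup>2" using xu(2) by (intro power_mono) auto
    moreover have "g y = f x + u\<^sup>2" using xu(2) by (simp add: g_def xu(3) e_div e_mod)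
    moreover have "f x \<le> D * z\<^sup>2" using f xu(1) by blast
    ultimately show "g y \<le> Suc D * z\<^sup>2" by (simp only: mult_Suc)
  qed
  moreover have "2 * g y \<le> g p + g q \<and> (g p + g q = 2 * g y \<longrightarrow> p = q)"
    if pyq: "p \<in> Y" "y \<in> Y" "q \<in> Y" and eq: "p + q = 2 * y" for p y q
  proof -
    obtain p1 p0 y1 y0 q1 q0 where dig: "p = e (p1, p0)" "y = e (y1, y0)" "q = e (q1, q0)"
      "p0 < z" "y0 < z" "q0 < z" "p1 \<in> X" "y1 \<in> X" "q1 \<in> X"
      using pyq by (auto simp: Y_def)
    have sum: "(p0 + q0) + 2 * z * (p1 + q1) = 2 * y0 + 2 * z * (2 * y1)"
      using eq dig by (simp add: e_def algebra_simps)
    \<comment> \<open>Sums of two digits stay below \<open>2 * z\<close>, so reducing modulo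
      \<open>2 * z\<close> isolates the lowest digits exactly.\<close>
    have "(p0 + q0) mod (2 * z) = (2 * y0) mod (2 * z)"
      using arg_cong[OF sum, of "\<lambda>x. x mod (2 * z)"] unfolding mod_mult_self2 .
    then have low: "p0 + q0 = 2 * y0" using dig by simp
    with sum z have high: "p1 + q1 = 2 * y1" by simp
    have g: "g p = f p1 + p0\<^sup>2" "g y = f y1 + y0\<^sup>2" "g q = f q1 + q0\<^sup>2"
      using dig by (simp_all add: g_def e_div e_mod)
    have "2 * (f y1 + y0\<^sup>2) \<le> (f p1 + p0\<^sup>2) + (f q1 + q0\<^sup>2) \<and>
      ((f p1 + p0\<^sup>2) + (f q1 + q0\<^sup>2) = 2 * (f y1 + y0\<^sup>2) \<longrightarrow> p1 = q1 \<and> p0 = q0)"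
      using conv[unfolded midpoint_convex_on_def, rule_format, OF dig(7-9) high] square_midpoint_nat[OF low]
      by auto
    then show ?thesis unfolding g using dig(1,3) by blast
  qed
  then have "midpoint_convex_on Y g" unfolding midpoint_convex_on_def by blast
  ultimately show ?case by blast
qed

text \<open>Behrend's sphere argument: the digit function takes at most
  \<open>D * z\<^sup>2 + 1\<close> values, so by pigeonhole some level set is large, and strict
  convexity makes it progression-free.\<close>

lemma three_AP_free_dense:
  assumes z: "z > 0"
  shows "\<exists>F. F \<subseteq> {..<(2 * z) ^ D} \<and> three_AP_free F \<and> z ^ D \<le> card F * (D * z\<^sup>2 + 1)"
proof -
  obtain X f where X: "X \<subseteq> {..<(2 * z) ^ D}" and card: "card X = z ^ D"
    and f: "\<forall>x\<in>X. f x \<le> D * z\<^sup>2"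
    and conv: "midpoint_convex_on X f"
    using midpoint_convex_digit_function[OF z, of D] by blast
  have fin: "finite X" using X finite_subset by blast
  have ne: "X \<noteq> {}" using card z by auto
  have "\<exists>t \<le> D * z\<^sup>2. z ^ D \<le> card {x\<in>X. f x = t} * (D * z\<^sup>2 + 1)"
  proof (rule ccontr)
    assume "\<not> ?thesis"
    then have small: "card {x\<in>X. f x = t} * (D * z\<^sup>2 + 1) < z ^ D" if "t \<le> D * z\<^sup>2" for t
      using that by (meson not_le)
    have "card X = (\<Sum>t\<in>{..D * z\<^sup>2}. card {x\<in>X. f x = t})"
    proof -
      have "X = (\<Union>t\<in>{..D * z\<^sup>2}. {x\<in>X. f x = t})" using f by auto
      then show ?thesis using fin by (subst card_UN_disjoint[symmetric]) auto
    qed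
    then have "card X * (D * z\<^sup>2 + 1) = (\<Sum>t\<in>{..D * z\<^sup>2}. card {x\<in>X. f x = t} * (D * z\<^sup>2 + 1))"
      by (simp only: sum_distrib_right)
    also have "\<dots> < (\<Sum>t\<in>{..D * z\<^sup>2}. z ^ D)"
      by (rule sum_strict_mono) (use small in auto)
    finally show False using card by simp
  qed
  then obtain t where t: "z ^ D \<le> card {x\<in>X. f x = t} * (D * z\<^sup>2 + 1)" by blast
  have "three_AP_free {x\<in>X. f x = t}"
    unfolding three_AP_free_def
  proof (intro allI impI notI)
    fix x d :: nat
    assume "d > 0" and "x \<in> {x\<in>X. f x = t} \<and> x + d \<in> {x\<in>X. f x = t} \<and> x + 2 * d \<in> {x\<in>X. f x = t}"
    moreover from this have "f x + f (x + 2 * d) = 2 * f (x + d) \<longrightarrow> x = x + 2 * d"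
      using conv[unfolded midpoint_convex_on_def, rule_format, of x "x + d" "x + 2 * d"] by auto
    ultimately show False by auto
  qed
  then show ?thesis using X t by (intro exI[of _ "{x\<in>X. f x = t}"]) auto
qed

section \<open>Random fibres over residue classes\<close>

text \<open>Independence in counting form: as \<open>v\<close> is injective, the constraints concern
  distinct coordinates, and the functions obeying them again form a product.\<close>

lemma card_PiE_prescribed:
  assumes V: "finite V" and J: "finite J" and v: "inj_on v J" "v ` J \<subseteq> V"
    and W: "finite \<Omega>" and C: "\<And>j. j \<in> J \<Longrightarrow> C j \<subseteq> \<Omega>"
  shows "card {g \<in> V \<rightarrow>\<^sub>E \<Omega>. \<forall>j\<in>J. g (v j) \<in> C j} = (\<Prod>j\<in>J. card (C j)) * card \<Omega> ^ (card V - card J)"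
proof -
  define C' where "C' x = (if x \<in> v ` J then C (the_inv_into J v x) else \<Omega>)" for x
  have C'v: "C' (v j) = C j" if "j \<in> J" for j
    using that v(1) by (simp add: C'_def the_inv_into_f_f)
  have "{g \<in> V \<rightarrow>\<^sub>E \<Omega>. \<forall>j\<in>J. g (v j) \<in> C j} = Pi\<^sub>E V C'"
  proof (intro set_eqI iffI)
    fix g assume g: "g \<in> {g \<in> V \<rightarrow>\<^sub>E \<Omega>. \<forall>j\<in>J. g (v j) \<in> C j}"
    have "g x \<in> C' x" if x: "x \<in> V" for x
    proof (cases "x \<in> v ` J")
      case True then show ?thesis using g C'v by auto
    next
      case False then show ?thesis using g x by (auto simp: C'_def)
    qed
    then show "g \<in> Pi\<^sub>E V C'" using g by (auto simp: PiE_iff)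
  next
    fix g assume g: "g \<in> Pi\<^sub>E V C'"
    have "C' x \<subseteq> \<Omega>" for x
      using C C'v by (cases "x \<in> v ` J") (auto simp: C'_def)
    moreover have "g (v j) \<in> C j" if "j \<in> J" for j
    proof -
      have "v j \<in> V" using v(2) that by blast
      then have "g (v j) \<in> C' (v j)" using g by (auto simp: PiE_iff)
      then show ?thesis using C'v[OF that] by simp
    qed
    ultimately show "g \<in> {g \<in> V \<rightarrow>\<^sub>E \<Omega>. \<forall>j\<in>J. g (v j) \<in> C j}" using g by (auto simp: PiE_iff)
  qed
  then have "card {g \<in> V \<rightarrow>\<^sub>E \<Omega>. \<forall>j\<in>J. g (v j) \<in> C j} = (\<Prod>x\<in>V. card (C' x))"
    using V by (simp add: card_PiE)
  also have "\<dots> = (\<Prod>x\<in>v ` J. card (C' x)) * (\<Prod>x\<in>V - v ` J. card (C' x))"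
    using prod.subset_diff[OF v(2) V, of "\<lambda>x. card (C' x)"] by (simp add: mult.commute)
  also have "(\<Prod>x\<in>v ` J. card (C' x)) = (\<Prod>j\<in>J. card (C j))"
    using v(1) C'v by (simp add: prod.reindex)
  also have "(\<Prod>x\<in>V - v ` J. card (C' x)) = (\<Prod>x\<in>V - v ` J. card \<Omega>)"
    by (rule prod.cong) (auto simp: C'_def)
  also have "\<dots> = card \<Omega> ^ (card V - card J)"
    using V J v by (simp add: card_Diff_subset card_image)
  finally show ?thesis .
qed

text \<open>The union bound for a uniformly random \<open>g\<close>. The bad event \<open>i\<close>
  is that every coordinate \<open>v i j\<close> takes a value in \<open>C i j\<close>; its
  probability is the product in \<open>less\<close>.\<close>

lemma first_moment:
  assumes I: "finite I" and V: "finite V" and W: "finite \<Omega>" "\<Omega> \<noteq> {}"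
    and J: "\<And>i. i \<in> I \<Longrightarrow> finite (J i)" and v: "\<And>i. i \<in> I \<Longrightarrow> inj_on (v i) (J i)"
      "\<And>i. i \<in> I \<Longrightarrow> v i ` J i \<subseteq> V"
    and C: "\<And>i j. i \<in> I \<Longrightarrow> j \<in> J i \<Longrightarrow> C i j \<subseteq> \<Omega>"
    and less: "(\<Sum>i\<in>I. \<Prod>j\<in>J i. real (card (C i j)) / real (card \<Omega>)) < 1"
  obtains g where "g \<in> V \<rightarrow>\<^sub>E \<Omega>" "\<And>i. i \<in> I \<Longrightarrow> \<exists>j\<in>J i. g (v i j) \<notin> C i j"
proof -
  define bad where "bad i = {g \<in> V \<rightarrow>\<^sub>E \<Omega>. \<forall>j\<in>J i. g (v i j) \<in> C i j}" for i
  have W0: "card \<Omega> > 0" using W by (simp add: card_gt_0_iff)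
  have bad: "real (card (bad i)) = (\<Prod>j\<in>J i. real (card (C i j)) / real (card \<Omega>)) * real (card \<Omega>) ^ card V"
    if i: "i \<in> I" for i
  proof -
    have le: "card (J i) \<le> card V"
      using card_inj_on_le[OF v(1) v(2) V] i by blast
    have "real (card (bad i)) = (\<Prod>j\<in>J i. real (card (C i j))) * real (card \<Omega>) ^ (card V - card (J i))"
      unfolding bad_def by (subst card_PiE_prescribed) (use V W J v C i in auto)
    also have "\<dots> = (\<Prod>j\<in>J i. real (card (C i j)) / real (card \<Omega>)) * real (card \<Omega>) ^ card V"
      using W0 le by (simp add: prod_dividef power_diff)
    finally show ?thesis .
  qed
  have fin: "finite (V \<rightarrow>\<^sub>E \<Omega>)" using V W by (intro finite_PiE) auto
  have "real (card (\<Union>i\<in>I. bad i)) \<le> (\<Sum>i\<in>I. real (card (bad i)))"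
    using card_UN_le[OF I, of bad] by (simp flip: of_nat_sum)
  also have "\<dots> = (\<Sum>i\<in>I. \<Prod>j\<in>J i. real (card (C i j)) / real (card \<Omega>)) * real (card \<Omega>) ^ card V"
    unfolding sum_distrib_right by (rule sum.cong) (use bad in auto)
  also have "\<dots> < 1 * real (card \<Omega>) ^ card V"
    using less W0 by (intro mult_strict_right_mono) auto
  also have "\<dots> = real (card (V \<rightarrow>\<^sub>E \<Omega>))" using V by (simp add: card_PiE)
  finally have "card (\<Union>i\<in>I. bad i) < card (V \<rightarrow>\<^sub>E \<Omega>)" by simp
  moreover have "finite (bad i)" for i
    unfolding bad_def by (rule finite_subset[OF _ fin]) blast
  then have "finite (\<Union>i\<in>I. bad i)" using I by blast
  ultimately have "\<not> (V \<rightarrow>\<^sub>E \<Omega>) \<subseteq> (\<Union>i\<in>I. bad i)"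
    using card_mono[of "\<Union>i\<in>I. bad i" "V \<rightarrow>\<^sub>E \<Omega>"] by linarith
  then obtain g where "g \<in> V \<rightarrow>\<^sub>E \<Omega>" "\<forall>i\<in>I. g \<notin> bad i" by blast
  then show thesis using that unfolding bad_def by blast
qed

section \<open>Progressions of residues modulo a prime\<close>

definition AP_mod :: "nat \<Rightarrow> nat \<Rightarrow> nat \<Rightarrow> nat \<Rightarrow> nat set" where
  "AP_mod m r y e = (\<lambda>i. (y + i * e) mod m) ` {..<r}"

lemma inj_on_AP_mod:
  fixes m r y e :: nat
  assumes m: "prime m" and e: "\<not> m dvd e" and r: "r \<le> m"
  shows "inj_on (\<lambda>i. (y + i * e) mod m) {..<r}"
proof -
  have neq: "(y + i * e) mod m \<noteq> (y + j * e) mod m" if "i < j" "j < r" for i j :: nat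
  proof
    assume "(y + i * e) mod m = (y + j * e) mod m"
    then have "(y + j * e) mod m = (y + i * e) mod m" ..
    then have "m dvd (y + j * e) - (y + i * e)"
      using that by (subst (asm) mod_eq_dvd_iff_nat) auto
    then have "m dvd (j - i) * e" by (simp add: diff_mult_distrib)
    then have "m dvd j - i" using m e prime_dvd_mult_nat by blast
    then have "m \<le> j - i" using that by (intro dvd_imp_le) auto
    then show False using that r by simp
  qed
  show ?thesis
  proof (rule inj_onI)
    fix i j assume "i \<in> {..<r}" "j \<in> {..<r}" "(y + i * e) mod m = (y + j * e) mod m"
    then show "i = j" using neq[of i j] neq[of j i] by (cases i j rule: linorder_cases) auto
  qed
qed

definition APs_mod :: "nat \<Rightarrow> nat \<Rightarrow> nat set set" where
  "APs_mod m r = {AP_mod m r y e | y e. 0 < e \<and> e < m}"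

lemma APs_mod_subset:
  assumes "m > 0" "S \<in> APs_mod m r"
  shows "S \<subseteq> {..<m}"
  using assms by (auto simp: APs_mod_def AP_mod_def)

lemma finite_in_APs_mod: "S \<in> APs_mod m r \<Longrightarrow> finite S"
  by (auto simp: APs_mod_def AP_mod_def)

lemma card_APs_mod:
  assumes "prime m" "r \<le> m" "S \<in> APs_mod m r"
  shows "card S = r"
proof -
  obtain y e where e: "0 < e" "e < m" and S: "S = AP_mod m r y e"
    using assms by (auto simp: APs_mod_def)
  have "\<not> m dvd e" using e by (rule nat_dvd_not_less)
  then show ?thesis unfolding S AP_mod_def using assms by (simp add: card_image inj_on_AP_mod)
qed

text \<open>A progression meeting \<open>X\<close> is determined by a common point \<open>x\<close>,
  its position \<open>i\<close> and the difference \<open>e\<close>. The start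
  \<open>x - i * e\<close> modulo \<open>m\<close> is written with \<open>m - e\<close> to avoid
  negative numbers.\<close>

lemma card_APs_mod_meeting:
  assumes X: "finite X" and m: "m > 0"
  shows "card {S \<in> APs_mod m r. S \<inter> X \<noteq> {}} \<le> card X * r * m"
proof -
  let ?f = "\<lambda>(x, i, e). AP_mod m r (x + i * (m - e)) e"
  have "{S \<in> APs_mod m r. S \<inter> X \<noteq> {}} \<subseteq> ?f ` (X \<times> {..<r} \<times> {..<m})"
  proof
    fix S assume "S \<in> {S \<in> APs_mod m r. S \<inter> X \<noteq> {}}"
    then obtain y e i where e: "0 < e" "e < m" and S: "S = AP_mod m r y e"
      and i: "i < r" "(y + i * e) mod m \<in> X"
      by (auto simp: APs_mod_def AP_mod_def)
    have "((y + i * e) mod m + i * (m - e) + i' * e) mod m = (y + i' * e) mod m" for i'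
    proof -
      have "i * e + i * (m - e) = i * m" using e by (metis add_mult_distrib2 le_add_diff_inverse less_imp_le)
      then have eq: "y + i * e + (i * (m - e) + i' * e) = (y + i' * e) + i * m" by linarith
      have "((y + i * e) mod m + i * (m - e) + i' * e) mod m = (y + i * e + (i * (m - e) + i' * e)) mod m"
        by (simp only: add.assoc mod_add_left_eq)
      also have "\<dots> = (y + i' * e) mod m" unfolding eq by simp
      finally show ?thesis .
    qed
    then have "S = ?f ((y + i * e) mod m, i, e)" by (simp add: S AP_mod_def)
    then show "S \<in> ?f ` (X \<times> {..<r} \<times> {..<m})" using i e by blast
  qed
  then have "card {S \<in> APs_mod m r. S \<inter> X \<noteq> {}} \<le> card (X \<times> {..<r} \<times> {..<m})"
    using X by (intro surj_card_le) auto
  then show ?thesis by (simp add: card_cartesian_product mult.assoc)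
qed

text \<open>A set missing the union of a maximal family could be added to it. Deleting that union
  therefore destroys every member of \<open>\<A>\<close>, and disjointness makes the cost easy to
  bound.\<close>

lemma maximal_disjoint_subfamily:
  assumes fin: "finite \<A>" and ne: "{} \<notin> \<A>"
  obtains \<F> where "\<F> \<subseteq> \<A>" "pairwise disjnt \<F>" "\<And>S. S \<in> \<A> \<Longrightarrow> S \<inter> \<Union>\<F> \<noteq> {}"
proof -
  define P where "P = {\<F>. \<F> \<subseteq> \<A> \<and> pairwise disjnt \<F>}"
  have "finite P" using fin by (simp add: P_def)
  moreover have "{} \<in> P" by (simp add: P_def)
  ultimately obtain \<F> where F: "\<F> \<in> P" and max: "\<And>\<G>. \<G> \<in> P \<Longrightarrow> \<F> \<subseteq> \<G> \<Longrightarrow> \<G> = \<F>"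
    using finite_has_maximal[of P] by (metis empty_iff)
  have "S \<inter> \<Union>\<F> \<noteq> {}" if S: "S \<in> \<A>" for S
  proof
    assume dis: "S \<inter> \<Union>\<F> = {}"
    then have "insert S \<F> \<in> P" using F S
      by (auto simp: P_def pairwise_insert disjnt_def)
    then have "S \<in> \<F>" using max by blast
    then have "S = {}" using dis by blast
    then show False using S ne by simp
  qed
  then show thesis using that F by (auto simp: P_def)
qed

lemma binomial_le_power: "n choose t \<le> n ^ t"
  by (cases "t \<le> n") (simp_all add: binomial_le_pow binomial_eq_0)

text \<open>A residue \<open>x\<close> modulo \<open>m\<close> receives the random fibre \<open>Fib (g x)\<close>. The two summands of the union
  bound control the events that some block of \<open>l\<close> consecutive terms of a \<open>k\<close>-term progression is not hit,
  and that \<open>t\<close> disjoint progressions of residues with nonempty fibres meet a \<open>k\<close>-term progression.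
  Outside these events, deleting a maximal disjoint family of such progressions of residues removes at
  most \<open>r * t\<close> of the at least \<open>r * t + 1\<close> terms that were hit.\<close>

lemma AP_free_hitting_set:
  fixes m n k r t l A H :: nat and \<Omega> :: "'w set" and Fib :: "'w \<Rightarrow> nat set"
  assumes m: "prime m" and r: "3 \<le> r" "r \<le> m" and k: "2 \<le> k" "k \<le> m"
    and n: "n \<le> m * (k - 1)" and l: "(r * t + 1) * l \<le> k"
    and fin: "finite \<Omega>" "\<Omega> \<noteq> {}"
    and free: "\<And>\<omega>. \<omega> \<in> \<Omega> \<Longrightarrow> three_AP_free (Fib \<omega>)"
    and A: "card {\<omega>\<in>\<Omega>. Fib \<omega> \<noteq> {}} \<le> A"
    and H: "\<And>q. q < k - 1 \<Longrightarrow> card {\<omega>\<in>\<Omega>. q \<notin> Fib \<omega>} \<le> H"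
    and less: "real (n * m) * (real (r * t + 1) * (real H / real (card \<Omega>)) ^ l +
      real (k * r * m) ^ t * (real A / real (card \<Omega>)) ^ (r * t)) < 1"
  obtains R where "\<And>a d. d > 0 \<Longrightarrow> \<exists>i<r. a + i * d \<notin> R"
    and "\<And>a d. d > 0 \<Longrightarrow> a + (k - 1) * d < n \<Longrightarrow> \<exists>j<k. a + j * d \<in> R"
proof -
  have m0: "m > 0" using m prime_gt_0_nat by blast
  define W where "W = real (card \<Omega>)"
  have W0: "W > 0" using fin by (simp add: W_def card_gt_0_iff)
  define D where "D = {(a, d). 0 < d \<and> a + (k - 1) * d < n}"
  have D_less: "d < m" if "(a, d) \<in> D" for a d
  proof -
    have "a + (k - 1) * d < n" using that by (simp add: D_def)
    then have "(k - 1) * d < (k - 1) * m" using n by (simp only: mult.commute[of m])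
    then show ?thesis by (rule mult_less_cancel1[THEN iffD1, THEN conjunct2])
  qed
  have D_sub: "D \<subseteq> {..<n} \<times> {..<m}" using D_less by (auto simp: D_def)
  have finD: "finite D" by (rule finite_subset[OF D_sub]) simp
  have cardD: "card D \<le> n * m"
    using card_mono[OF _ D_sub] by (simp add: card_cartesian_product)
  \<comment> \<open>The residue of a term selects the random coordinate, and the quotient is what
    must lie in its fibre.\<close>
  define res where "res = (\<lambda>(a, d) j. (a + j * d) mod m)"
  define quo where "quo = (\<lambda>(a, d) j. (a + j * d) div m)"
  have res_inj: "inj_on (res P) {..<k}" if "P \<in> D" for P
  proof -
    obtain a d where P: "P = (a, d)" by (cases P)
    have "0 < d" "d < m" using that D_less[of a d] unfolding P D_def by simp_all
    then have "\<not> m dvd d" by (rule nat_dvd_not_less)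
    then show ?thesis unfolding P res_def prod.case by (rule inj_on_AP_mod[OF m _ k(2)])
  qed
  have res_less: "res P j < m" for P j using m0 by (auto simp: res_def split: prod.split)
  have quo_less: "quo P j < k - 1" if P: "P \<in> D" and j: "j < k" for P j
  proof -
    obtain a d where P': "P = (a, d)" by (cases P)
    have "j * d \<le> (k - 1) * d" using j by (intro mult_le_mono1) simp
    moreover have "a + (k - 1) * d < n" using P by (simp add: P' D_def)
    ultimately have "a + j * d < (k - 1) * m" using n by (simp only: mult.commute[of m])
    then show ?thesis unfolding P' quo_def prod.case by (rule less_mult_imp_div_less)
  qed
  define near where "near P = {S \<in> APs_mod m r. S \<inter> res P ` {..<k} \<noteq> {}}" for P
  have fin_APs: "finite (APs_mod m r)"
    using APs_mod_subset[OF m0] finite_subset[of "APs_mod m r" "Pow {..<m}"] by auto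
  have fin_near: "finite (near P)" for P using fin_APs by (simp add: near_def)
  have card_near: "card (near P) \<le> k * r * m" for P
  proof -
    have "card (near P) \<le> card (res P ` {..<k}) * r * m"
      unfolding near_def by (rule card_APs_mod_meeting) (simp_all add: m0)
    also have "\<dots> \<le> k * r * m"
      by (intro mult_le_mono1) (use card_image_le[of "{..<k}" "res P"] in simp)
    finally show ?thesis .
  qed
  define fam where "fam P = {\<S>. \<S> \<subseteq> near P \<and> card \<S> = t \<and> pairwise disjnt \<S>}" for P
  have fin_fam: "finite (fam P)" for P
    by (rule finite_subset[of _ "Pow (near P)"]) (auto simp: fam_def fin_near)
  have card_fam: "card (fam P) \<le> (k * r * m) ^ t" for P
  proof -
    have "card (fam P) \<le> card {\<S>. \<S> \<subseteq> near P \<and> card \<S> = t}"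
      by (rule card_mono) (auto simp: fam_def fin_near)
    also have "\<dots> \<le> card (near P) ^ t" by (simp add: n_subsets fin_near binomial_le_power)
    also have "\<dots> \<le> (k * r * m) ^ t" by (rule power_mono[OF card_near]) simp
    finally show ?thesis .
  qed
  have card_Union_fam: "card (\<Union>\<S>) = r * t" if "\<S> \<in> fam P" for \<S> P
  proof -
    have sub: "\<S> \<subseteq> APs_mod m r" using that by (auto simp: fam_def near_def)
    have "card (\<Union>\<S>) = sum card \<S>"
      using that sub by (intro card_Union_disjoint) (auto simp: fam_def intro: finite_in_APs_mod)
    also have "\<dots> = (\<Sum>S\<in>\<S>. r)" using sub card_APs_mod[OF m r(2)] by (intro sum.cong) auto
    finally show ?thesis using that by (simp add: fam_def)
  qed

  have Union_fam: "\<Union>\<S> \<subseteq> {..<m}" if "\<S> \<in> fam P" for \<S> P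
    using that APs_mod_subset[OF m0] by (fastforce simp: fam_def near_def)
  \<comment> \<open>The bad events are of two kinds: \<open>Inl (P, b)\<close> says that block
    \<open>b\<close> of \<open>P\<close> is not hit, and \<open>Inr (P, \<S>)\<close> that all
    residues covered by \<open>\<S>\<close> have nonempty fibres. \<open>J\<close>, \<open>v\<close>
    and \<open>C\<close> put both into the form of \<open>first_moment\<close>.\<close>
  define I1 where "I1 = D \<times> {..<r * t + 1}"
  define I2 where "I2 = Sigma D fam"
  define J where "J = case_sum (\<lambda>(P :: nat \<times> nat, b). {b * l..<b * l + l}) (\<lambda>(P :: nat \<times> nat, \<S>). \<Union>\<S>)"
  define v where "v = case_sum (\<lambda>(P, b :: nat). res P) (\<lambda>(P :: nat \<times> nat, \<S> :: nat set set) x. x)"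
  define C where "C = case_sum (\<lambda>(P, b :: nat) j. {\<omega>\<in>\<Omega>. quo P j \<notin> Fib \<omega>})
    (\<lambda>(P :: nat \<times> nat, \<S> :: nat set set) x. {\<omega>\<in>\<Omega>. Fib \<omega> \<noteq> {}})"
  have block: "{b * l..<b * l + l} \<subseteq> {..<k}" if "b < r * t + 1" for b
  proof -
    have "Suc b * l \<le> (r * t + 1) * l" using that by (intro mult_le_mono1) simp
    then have "Suc b * l \<le> k" using l by (rule le_trans)
    then show ?thesis by auto
  qed
  have inj_block: "inj_on (res P) {b * l..<b * l + l}" if "P \<in> D" "b < r * t + 1" for P b
    by (rule inj_on_subset[OF res_inj[OF that(1)] block[OF that(2)]])
  have sum1: "(\<Sum>i\<in>I1. \<Prod>j\<in>J (Inl i). real (card (C (Inl i) j)) / W) \<le> real (n * m) * (real (r * t + 1) * (real H / W) ^ l)"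
  proof -
    have "(\<Prod>j\<in>J (Inl i). real (card (C (Inl i) j)) / W) \<le> (real H / W) ^ l" if "i \<in> I1" for i
    proof -
      obtain P b where i: "i = (P, b)" by (cases i)
      have "(\<Prod>j\<in>J (Inl i). real (card (C (Inl i) j)) / W) \<le> (\<Prod>j\<in>J (Inl i). real H / W)"
      proof (rule prod_mono, intro conjI divide_right_mono)
        fix j assume "j \<in> J (Inl i)"
        then have "quo P j < k - 1" using that block[of b] by (intro quo_less) (auto simp: i J_def I1_def)
        then show "real (card (C (Inl i) j)) \<le> real H" using H by (simp add: i C_def)
      qed (use W0 in auto)
      also have "\<dots> = (real H / W) ^ l" by (simp add: i J_def)
      finally show ?thesis .
    qed
    then have "(\<Sum>i\<in>I1. \<Prod>j\<in>J (Inl i). real (card (C (Inl i) j)) / W) \<le> (\<Sum>i\<in>I1. (real H / W) ^ l)"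
      by (rule sum_mono)
    also have "\<dots> = real (card D) * (real (r * t + 1) * (real H / W) ^ l)"
      by (simp add: I1_def card_cartesian_product algebra_simps)
    also have "\<dots> \<le> real (n * m) * (real (r * t + 1) * (real H / W) ^ l)"
      using cardD W0 by (intro mult_right_mono of_nat_mono) simp_all
    finally show ?thesis .
  qed
  have sum2: "(\<Sum>i\<in>I2. \<Prod>j\<in>J (Inr i). real (card (C (Inr i) j)) / W) \<le> real (n * m) * (real (k * r * m) ^ t * (real A / W) ^ (r * t))"
  proof -
    have "(\<Prod>j\<in>J (Inr i). real (card (C (Inr i) j)) / W) \<le> (real A / W) ^ (r * t)" if "i \<in> I2" for i
    proof -
      obtain P \<S> where i: "i = (P, \<S>)" by (cases i)
      have "(\<Prod>j\<in>J (Inr i). real (card (C (Inr i) j)) / W) = (real (card {\<omega>\<in>\<Omega>. Fib \<omega> \<noteq> {}}) / W) ^ card (\<Union>\<S>)"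
        by (simp add: i J_def C_def)
      also have "\<dots> = (real (card {\<omega>\<in>\<Omega>. Fib \<omega> \<noteq> {}}) / W) ^ (r * t)"
        using card_Union_fam[of \<S> P] that by (simp add: i I2_def)
      also have "\<dots> \<le> (real A / W) ^ (r * t)"
        using A W0 by (intro power_mono divide_right_mono) auto
      finally show ?thesis .
    qed
    then have "(\<Sum>i\<in>I2. \<Prod>j\<in>J (Inr i). real (card (C (Inr i) j)) / W) \<le> (\<Sum>i\<in>I2. (real A / W) ^ (r * t))"
      by (rule sum_mono)
    also have "\<dots> = real (card I2) * (real A / W) ^ (r * t)" by simp
    also have "\<dots> \<le> real (n * m * (k * r * m) ^ t) * (real A / W) ^ (r * t)"
    proof -
      have "card I2 = (\<Sum>P\<in>D. card (fam P))" unfolding I2_def by (simp add: finD fin_fam)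
      also have "\<dots> \<le> (\<Sum>P\<in>D. (k * r * m) ^ t)" by (rule sum_mono[OF card_fam])
      also have "\<dots> \<le> n * m * (k * r * m) ^ t" using cardD by simp
      finally show ?thesis using W0 by (intro mult_right_mono of_nat_mono) simp_all
    qed
    finally show ?thesis by (simp add: algebra_simps)
  qed
  have sum: "(\<Sum>i\<in>I1 <+> I2. \<Prod>j\<in>J i. real (card (C i j)) / real (card \<Omega>)) < 1"
  proof -
    have "(\<Sum>i\<in>I1 <+> I2. \<Prod>j\<in>J i. real (card (C i j)) / W) =
      (\<Sum>i\<in>I1. \<Prod>j\<in>J (Inl i). real (card (C (Inl i) j)) / W) + (\<Sum>i\<in>I2. \<Prod>j\<in>J (Inr i). real (card (C (Inr i) j)) / W)"
      using finD fin_fam by (subst sum.Plus) (auto simp: I1_def I2_def)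
    also have "\<dots> < 1"
      using sum1 sum2 less by (simp add: W_def distrib_left)
    finally show ?thesis by (simp add: W_def)
  qed
  obtain g where g: "g \<in> {..<m} \<rightarrow>\<^sub>E \<Omega>" and avoid: "\<And>i. i \<in> I1 <+> I2 \<Longrightarrow> \<exists>j\<in>J i. g (v i j) \<notin> C i j"
  proof (rule first_moment[of "I1 <+> I2" "{..<m}" \<Omega> J v C])
    show "finite (I1 <+> I2)" using finD fin_fam by (auto simp: I1_def I2_def)
    fix i assume i: "i \<in> I1 <+> I2"
    show "finite (J i)"
      using i by (auto simp: J_def I2_def intro: finite_subset[OF Union_fam])
    show "inj_on (v i) (J i)"
      using i inj_block by (auto simp: v_def J_def I1_def I2_def)
    show "v i ` J i \<subseteq> {..<m}"
      using i res_less Union_fam by (fastforce simp: v_def J_def I1_def I2_def)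
    show "\<And>j. j \<in> J i \<Longrightarrow> C i j \<subseteq> \<Omega>"
      using i by (auto simp: C_def)
  qed (use fin sum in auto)

  define L where "L = {x. x < m \<and> Fib (g x) \<noteq> {}}"
  have g_in: "g x \<in> \<Omega>" if "x < m" for x using g that by (auto simp: PiE_iff)
  obtain \<F> where F: "\<F> \<subseteq> {S \<in> APs_mod m r. S \<subseteq> L}" "pairwise disjnt \<F>"
    and F_max: "\<And>S. S \<in> {S \<in> APs_mod m r. S \<subseteq> L} \<Longrightarrow> S \<inter> \<Union>\<F> \<noteq> {}"
  proof (rule maximal_disjoint_subfamily[of "{S \<in> APs_mod m r. S \<subseteq> L}"])
    show "{} \<notin> {S \<in> APs_mod m r. S \<subseteq> L}" using card_APs_mod[OF m r(2), of "{}"] r by auto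
  qed (use fin_APs in auto)
  \<comment> \<open>The red points lie in the chosen fibres, after dropping all residues covered by
    \<open>\<F>\<close>.\<close>
  define R where "R = {x. x mod m \<in> L - \<Union>\<F> \<and> x div m \<in> Fib (g (x mod m))}"
  show thesis
  proof (rule that[of R])
    fix a d :: nat assume d: "d > 0"
    show "\<exists>i<r. a + i * d \<notin> R"
    proof (rule ccontr)
      assume "\<not> ?thesis"
      then have all: "a + i * d \<in> R" if "i < r" for i using that by blast
      show False
      proof (cases "m dvd d")
        \<comment> \<open>All terms share one residue class, and their quotients form a progression
          inside one fibre; \<open>r \<ge> 3\<close> suffices for a contradiction.\<close>
        case True
        then obtain c where c: "d = m * c" by blast
        then have c0: "c > 0" using d by (cases c) auto
        have shift: "(a + i * d) mod m = a mod m" "(a + i * d) div m = a div m + i * c" for i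
        proof -
          have eq: "a + i * d = a + (i * c) * m" by (simp add: c)
          show "(a + i * d) mod m = a mod m" unfolding eq by simp
          show "(a + i * d) div m = a div m + i * c" unfolding eq using m0 by simp
        qed
        have "a div m + i * c \<in> Fib (g (a mod m))" if "i < 3" for i
          using all[of i] that r(1) unfolding R_def by (simp add: shift)
        from this[of 0] this[of 1] this[of 2] show False
          using free[OF g_in[of "a mod m"]] c0 m0 by (auto simp: three_AP_free_def)
      next
        \<comment> \<open>The residues form a progression inside \<open>L\<close> that misses
          \<open>\<Union>\<F>\<close>, against the maximality of \<open>\<F>\<close>.\<close>
        case False
        have "0 < d mod m" "d mod m < m" using False m0 by (simp_all add: mod_greater_zero_iff_not_dvd)
        then have AP: "AP_mod m r a (d mod m) \<in> APs_mod m r" unfolding APs_mod_def by blast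
        have "AP_mod m r a (d mod m) = (\<lambda>i. (a + i * d) mod m) ` {..<r}"
          unfolding AP_mod_def by (intro image_cong refl) (metis mod_add_right_eq mod_mult_right_eq)
        also have "\<dots> \<subseteq> L - \<Union>\<F>" using all unfolding R_def by blast
        finally have sub: "AP_mod m r a (d mod m) \<subseteq> L - \<Union>\<F>" .
        then have "AP_mod m r a (d mod m) \<inter> \<Union>\<F> \<noteq> {}" using AP by (intro F_max) blast
        then show False using sub by blast
      qed
    qed
  next
    fix a d :: nat assume "d > 0" "a + (k - 1) * d < n"
    then have D: "(a, d) \<in> D" by (simp add: D_def)
    define near_F where "near_F = {S\<in>\<F>. S \<inter> res (a, d) ` {..<k} \<noteq> {}}"
    have near_F: "near_F \<subseteq> near (a, d)" using F by (auto simp: near_F_def near_def)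
    have "card near_F < t"
    proof (rule ccontr)
      assume "\<not> card near_F < t"
      then obtain \<S> where S: "\<S> \<subseteq> near_F" "card \<S> = t"
        using obtain_subset_with_card_n[of t near_F] by (metis not_less)
      have "pairwise disjnt \<S>" using F(2) S(1) by (auto simp: near_F_def intro: pairwise_subset)
      then have "((a, d), \<S>) \<in> I2" using D S near_F by (auto simp: I2_def fam_def)
      then have "\<exists>x\<in>\<Union>\<S>. g x \<notin> {\<omega>\<in>\<Omega>. Fib \<omega> \<noteq> {}}"
        using avoid[of "Inr ((a, d), \<S>)"] by (simp add: J_def v_def C_def InrI)
      moreover have "\<Union>\<S> \<subseteq> L" using S(1) F(1) by (auto simp: near_F_def)
      ultimately show False using g_in by (auto simp: L_def)
    qed
    have "\<exists>j\<in>{b * l..<b * l + l}. quo (a, d) j \<in> Fib (g (res (a, d) j))" if "b < r * t + 1" for b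
    proof -
      have "Inl ((a, d), b) \<in> I1 <+> I2" using D that by (intro InlI) (simp add: I1_def)
      from avoid[OF this] show ?thesis using g_in[OF res_less] by (auto simp: J_def v_def C_def)
    qed
    then obtain j where j: "\<And>b. b < r * t + 1 \<Longrightarrow> j b \<in> {b * l..<b * l + l}"
      and hit: "\<And>b. b < r * t + 1 \<Longrightarrow> quo (a, d) (j b) \<in> Fib (g (res (a, d) (j b)))"
      by metis
    have jk: "j b < k" if "b < r * t + 1" for b using j[OF that] block[OF that] by auto
    \<comment> \<open>One hit per block gives distinct indices, since division by \<open>l\<close>
      recovers the block, and hence distinct residues.\<close>
    have inj: "inj_on (\<lambda>b. res (a, d) (j b)) {..<r * t + 1}"
    proof (rule inj_onI)
      fix b b' assume b: "b \<in> {..<r * t + 1}" "b' \<in> {..<r * t + 1}" "res (a, d) (j b) = res (a, d) (j b')"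
      then have "j b = j b'" using jk by (intro inj_onD[OF res_inj[OF D] b(3)]) simp_all
      moreover have "j c div l = c" if "c < r * t + 1" for c
        by (rule div_nat_eqI) (use j[OF that] in \<open>simp_all add: mult.commute\<close>)
      ultimately show "b = b'" using b(1,2) by (metis lessThan_iff)
    qed
    show "\<exists>j<k. a + j * d \<in> R"
    proof (rule ccontr)
      assume no: "\<not> ?thesis"
      have "(\<lambda>b. res (a, d) (j b)) ` {..<r * t + 1} \<subseteq> \<Union>near_F"
      proof (rule image_subsetI)
        fix b assume "b \<in> {..<r * t + 1}"
        then have b: "b < r * t + 1" by simp
        have "res (a, d) (j b) \<in> L" using hit[OF b] res_less by (auto simp: L_def)
        moreover have "a + j b * d \<notin> R" using no jk[OF b] by blast
        ultimately have "res (a, d) (j b) \<in> \<Union>\<F>"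
          using hit[OF b] by (auto simp: R_def res_def quo_def)
        then show "res (a, d) (j b) \<in> \<Union>near_F" using jk[OF b] by (auto simp: near_F_def)
      qed
      moreover have fin_near_F: "finite near_F" using near_F fin_near finite_subset by blast
      moreover have sub: "S \<in> APs_mod m r" if "S \<in> near_F" for S using that F(1) by (auto simp: near_F_def)
      ultimately have "card ((\<lambda>b. res (a, d) (j b)) ` {..<r * t + 1}) \<le> card (\<Union>near_F)"
        by (intro card_mono finite_Union) (auto intro: finite_in_APs_mod)
      also have "\<dots> \<le> (\<Sum>S\<in>near_F. card S)" by (rule card_Union_le_sum_card)
      also have "\<dots> = (\<Sum>S\<in>near_F. r)" using sub card_APs_mod[OF m r(2)] by (intro sum.cong) auto
      also have "\<dots> \<le> t * r" using \<open>card near_F < t\<close> by simp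
      finally show False unfolding card_image[OF inj] by (simp add: mult.commute)
    qed
  qed
qed

section \<open>The fibre distribution and the resulting colouring\<close>

text \<open>The first coordinate of \<open>\<omega>\<close> makes a fibre nonempty with probability
  at most \<open>1 / B\<close>; the second selects a translate of \<open>F\<close>. For
  \<open>q < Q\<close> every \<open>f\<close> in \<open>F\<close> has its own shift
  \<open>s = q + Q - f\<close> below \<open>2 * Q\<close> that places \<open>q\<close> in the
  fibre.\<close>

lemma random_fibres:
  assumes F: "F \<subseteq> {..<Q}" "three_AP_free F"
  shows "\<exists>Fib :: nat \<times> nat \<Rightarrow> nat set. (\<forall>\<omega>. three_AP_free (Fib \<omega>)) \<and>
    card {\<omega> \<in> {..<B} \<times> {..<2 * Q}. Fib \<omega> \<noteq> {}} \<le> 2 * Q \<and>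
    (\<forall>q<Q. card {\<omega> \<in> {..<B} \<times> {..<2 * Q}. q \<notin> Fib \<omega>} \<le> B * (2 * Q) - card F)"
proof -
  \<comment> \<open>The equation \<open>q + Q = f + s\<close> encodes a translation by
    \<open>s - Q\<close> without negative numbers.\<close>
  define Fib where "Fib = (\<lambda>(b, s). if b = (0 :: nat) then {q. \<exists>f\<in>F. q + Q = f + s} else {})"
  let ?\<Omega> = "{..<B} \<times> {..<2 * Q}"
  have "three_AP_free (Fib \<omega>)" for \<omega>
  proof (cases "\<omega>")
    case (Pair b s)
    show ?thesis unfolding three_AP_free_def
    proof (intro allI impI notI, elim conjE)
      fix x d :: nat assume d: "d > 0" and "x \<in> Fib \<omega>" "x + d \<in> Fib \<omega>" "x + 2 * d \<in> Fib \<omega>"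
      then obtain f f' f'' where "f \<in> F" "f' \<in> F" "f'' \<in> F"
        and "x + Q = f + s" "x + d + Q = f' + s" "x + 2 * d + Q = f'' + s"
        by (auto simp: Fib_def Pair split: if_splits)
      moreover from this have "f' = f + d" "f'' = f + 2 * d" by linarith+
      ultimately show False using F(2) d unfolding three_AP_free_def by blast
    qed
  qed
  moreover have "card {\<omega> \<in> ?\<Omega>. Fib \<omega> \<noteq> {}} \<le> card ({0 :: nat} \<times> {..<2 * Q})"
    by (intro card_mono) (auto simp: Fib_def split: if_splits)
  moreover have "card {\<omega> \<in> ?\<Omega>. q \<notin> Fib \<omega>} \<le> B * (2 * Q) - card F" if q: "q < Q" for q
  proof (cases "B = 0")
    case False
    let ?G = "(\<lambda>f. (0 :: nat, q + Q - f)) ` F"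
    have sub: "?G \<subseteq> ?\<Omega>" using F(1) q False by auto
    have "inj_on (\<lambda>f. (0 :: nat, q + Q - f)) F"
      using F(1) by (intro inj_onI) (auto dest!: subsetD)
    then have cardG: "card ?G = card F" by (rule card_image)
    have "{\<omega> \<in> ?\<Omega>. q \<notin> Fib \<omega>} \<subseteq> ?\<Omega> - ?G"
      using F(1) by (force simp: Fib_def)
    then have "card {\<omega> \<in> ?\<Omega>. q \<notin> Fib \<omega>} \<le> card (?\<Omega> - ?G)" by (intro card_mono) auto
    also have "\<dots> = B * (2 * Q) - card F"
      using sub by (subst card_Diff_subset) (auto simp: cardG card_cartesian_product intro: finite_subset[OF sub])
    finally show ?thesis .
  qed simp
  ultimately show ?thesis by (intro exI[of _ Fib]) simp
qed

text \<open>The sample space has \<open>2 * B * (k - 1)\<close> points, so a residue has a nonempty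
  fibre with probability at most \<open>1 / B\<close> and a given quotient is missed with
  probability at most \<open>1 - card F / (2 * B * (k - 1))\<close>.\<close>

lemma vdW_gt_if_union_bound:
  fixes m r k t l B :: nat
  assumes m: "prime m" and r: "3 \<le> r" "r \<le> m" and k: "2 \<le> k" "k \<le> m"
    and F: "F \<subseteq> {..<k - 1}" "three_AP_free F" and B: "B > 0" and l: "(r * t + 1) * l \<le> k"
    and less: "real (m * (k - 1) * m) * (real (r * t + 1) * (1 - real (card F) / real (B * (2 * (k - 1)))) ^ l +
      real (k * r * m) ^ t * (1 / real B) ^ (r * t)) < 1"
  shows "vdW r k > m * (k - 1)"
proof -
  define Q where "Q = k - 1"
  define \<Omega> where "\<Omega> = {..<B} \<times> {..<2 * Q}"
  obtain Fib :: "nat \<times> nat \<Rightarrow> nat set" where free: "\<And>\<omega>. three_AP_free (Fib \<omega>)"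
    and act: "card {\<omega> \<in> \<Omega>. Fib \<omega> \<noteq> {}} \<le> 2 * Q"
    and hit: "\<And>q. q < Q \<Longrightarrow> card {\<omega> \<in> \<Omega>. q \<notin> Fib \<omega>} \<le> B * (2 * Q) - card F"
    using random_fibres[OF F, of B] unfolding \<Omega>_def Q_def by blast
  have Q: "Q > 0" using k by (simp add: Q_def)
  have card\<Omega>: "card \<Omega> = B * (2 * Q)" by (simp add: \<Omega>_def card_cartesian_product)
  have "card F \<le> Q" using card_mono[OF _ F(1)] by (simp add: Q_def)
  also have "Q \<le> B * (2 * Q)" using B by (cases B) auto
  finally have cF: "card F \<le> B * (2 * Q)" .
  have p: "real (B * (2 * Q) - card F) / real (card \<Omega>) = 1 - real (card F) / real (B * (2 * Q))"
    using B Q cF by (simp add: card\<Omega> of_nat_diff diff_divide_distrib)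
  have \<alpha>: "real (2 * Q) / real (card \<Omega>) = 1 / real B"
    using Q by (simp add: card\<Omega>)
  obtain R where R_free: "\<And>a d. d > 0 \<Longrightarrow> \<exists>i<r. a + i * d \<notin> R"
    and R_hit: "\<And>a d. d > 0 \<Longrightarrow> a + (k - 1) * d < m * (k - 1) \<Longrightarrow> \<exists>j<k. a + j * d \<in> R"
  proof (rule AP_free_hitting_set[OF m r k order_refl l])
    show "finite \<Omega>" by (simp add: \<Omega>_def)
    show "\<Omega> \<noteq> {}" using card\<Omega> B Q by auto
    show "three_AP_free (Fib \<omega>)" for \<omega> by (rule free)
    show "card {\<omega> \<in> \<Omega>. Fib \<omega> \<noteq> {}} \<le> 2 * Q" by (rule act)
    show "card {\<omega> \<in> \<Omega>. q \<notin> Fib \<omega>} \<le> B * (2 * Q) - card F" if "q < k - 1" for q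
      using that by (intro hit) (simp add: Q_def)
    show "real (m * (k - 1) * m) * (real (r * t + 1) * (real (B * (2 * Q) - card F) / real (card \<Omega>)) ^ l +
      real (k * r * m) ^ t * (real (2 * Q) / real (card \<Omega>)) ^ (r * t)) < 1"
      unfolding p \<alpha> using less by (simp only: Q_def)
  qed (rule that; blast)
  \<comment> \<open>The shift passes from \<open>{1..n}\<close> to \<open>{0..<n}\<close>;
    truncation affects only \<open>x = 0\<close>, which lies outside the range.\<close>
  define \<chi> where "\<chi> x = (if x - 1 \<in> R then Red else Blue)" for x :: nat
  show ?thesis
  proof (rule vdW_gt[of _ \<chi>]; unfold has_mono_AP_def; intro notI; elim exE conjE)
    fix a d :: nat assume d: "d > 0" and AP: "\<forall>i<r. a + i * d \<in> {1..m * (k - 1)} \<and> \<chi> (a + i * d) = Red"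
    have a: "a \<ge> 1" using AP[rule_format, of 0] r by simp
    have "(a - 1) + i * d \<in> R" if "i < r" for i
    proof -
      have "\<chi> (a + i * d) = Red" using AP that by blast
      then show ?thesis using a by (simp add: \<chi>_def split: if_splits)
    qed
    with R_free[OF d] show False by blast
  next
    fix a d :: nat assume d: "d > 0" and AP: "\<forall>i<k. a + i * d \<in> {1..m * (k - 1)} \<and> \<chi> (a + i * d) = Blue"
    have a: "a \<ge> 1" using AP[rule_format, of 0] k by simp
    have "a + (k - 1) * d \<le> m * (k - 1)" using AP[rule_format, of "k - 1"] k by simp
    then have "(a - 1) + (k - 1) * d < m * (k - 1)" using a by linarith
    then obtain j where j: "j < k" "(a - 1) + j * d \<in> R" using R_hit[OF d] by blast
    then have "\<chi> (a + j * d) = Red" using a by (simp add: \<chi>_def)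
    with AP j(1) show False by simp
  qed
qed

section \<open>Choice of parameters\<close>

lemma eventually_power_less_exp:
  fixes K c :: real
  assumes c: "c > 0"
  shows "\<forall>\<^sub>F z :: nat in sequentially. K * real z ^ a < exp (c * real z)"
proof -
  have "((\<lambda>x :: real. x ^ a / exp x) \<longlongrightarrow> 0) at_top" by (rule tendsto_power_div_exp_0)
  moreover have "filterlim (\<lambda>z :: nat. c * real z) at_top sequentially"
    using c by (intro filterlim_tendsto_pos_mult_at_top[OF tendsto_const] filterlim_real_sequentially)
  ultimately have "((\<lambda>z :: nat. (c * real z) ^ a / exp (c * real z)) \<longlongrightarrow> 0) sequentially"
    by (rule filterlim_compose)
  then have "((\<lambda>z :: nat. (K / c ^ a) * ((c * real z) ^ a / exp (c * real z))) \<longlongrightarrow> (K / c ^ a) * 0) sequentially"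
    by (intro tendsto_mult tendsto_const)
  then have "\<forall>\<^sub>F z :: nat in sequentially. (K / c ^ a) * ((c * real z) ^ a / exp (c * real z)) < 1"
    by (rule order_tendstoD(2)) simp
  then show ?thesis
    by eventually_elim (use c in \<open>simp add: power_mult_distrib field_simps\<close>)
qed

text \<open>With \<open>k\<close> of order \<open>z ^ D\<close>, all parameters are bounded by
  powers of \<open>z\<close>, and \<open>F\<close> fits below \<open>k - 1\<close>. An unhit block
  then has probability exponentially small in \<open>z\<close>, which beats every polynomial
  factor.\<close>

lemma vdW_lower_bound_at_scale:
  fixes s :: nat
  assumes s: "s \<ge> 1"
  defines "D \<equiv> 12 * s + 24"
  shows "\<forall>\<^sub>F z in sequentially. \<forall>k. (2 * z) ^ D < k \<and> k \<le> (2 * z + 2) ^ D \<longrightarrow> k ^ (s + 1) < vdW (s + 2) k"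
proof -
  \<comment> \<open>The prime will be at most \<open>C * z ^ a\<close>. The number of pairs is then
    \<open>O(z ^ (2 * a + D))\<close>, and \<open>t\<close> is one larger than this exponent.
    \<open>C\<close> absorbs constants, and \<open>c\<close> is the exponential rate for unhit
    blocks.\<close>
  define a where "a = D * s + 2"
  define t where "t = 2 * a + D + 1"
  define r where "r = s + 2"
  define C where "C = 2 * r * 4 ^ (D * r)"
  define c where "c = 1 / (4 * (real D + 1) * 4 ^ D * real (r * t + 1))"
  have c: "c > 0" by (simp add: c_def add_pos_nonneg)
  have "C > 0" by (simp add: C_def r_def)
  then have C1: "C \<ge> 1" by simp
  \<comment> \<open>Condition 2 will produce the prime, 3 bounds the term for unhit blocks, and 1
    bounds the term for disjoint progressions.\<close>
  have 1: "\<forall>\<^sub>F z in sequentially. 2 * C ^ 3 < z \<and> r * t + 1 < z" by (intro eventually_conj eventually_gt_at_top)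
  have 2: "\<forall>\<^sub>F z :: nat in sequentially. real (C ^ 2) * real z ^ (2 * a) < exp (ln 2 * real z)"
    by (rule eventually_power_less_exp) simp
  have 3: "\<forall>\<^sub>F z :: nat in sequentially. (2 * real (C ^ 3) * real (r * t + 1)) * real z ^ (2 * a + D) < exp (c * real z)"
    by (rule eventually_power_less_exp[OF c])
  from 1 2 3 show ?thesis
  proof eventually_elim
    case (elim z)
    have z_big: "2 * C ^ 3 < z" "r * t + 1 < z" using elim(1) by blast+
    have z0: "z > 0" using z_big by simp
    have CleC3: "C \<le> C ^ 3" using C1 by (simp add: self_le_power)
    have rC: "r \<le> C" by (simp add: C_def)
    show ?case
    proof (intro allI impI, elim conjE)
      fix k assume k_lower: "(2 * z) ^ D < k" and k_upper: "k \<le> (2 * z + 2) ^ D"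
      have "(2 * z + 2) ^ D \<le> (4 * z) ^ D" using z0 by (intro power_mono) auto
      then have k4: "k \<le> 4 ^ D * z ^ D" using k_upper by (simp add: power_mult_distrib)
      have D1: "D \<ge> 1" by (simp add: D_def)
      have zk: "z \<le> k"
      proof -
        have "z \<le> (2 * z) ^ 1" by simp
        also have "\<dots> \<le> (2 * z) ^ D" using z0 D1 by (intro power_increasing) auto
        finally show ?thesis using k_lower by simp
      qed
      have k2: "k \<ge> 2" using zk elim by simp
      have kC: "k \<le> C * z ^ D"
      proof -
        have "4 ^ D \<le> (4 :: nat) ^ (D * r)" by (intro power_increasing) (simp_all add: r_def)
        also have "\<dots> \<le> C" by (simp add: C_def r_def)
        finally have "4 ^ D * z ^ D \<le> C * z ^ D" by simp
        with k4 show ?thesis by linarith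
      qed
      \<comment> \<open>The factor \<open>z ^ 2\<close> is the room needed for a prime above
        \<open>2 * k ^ s\<close>: the condition of \<open>prime_between\<close> reduces to
        \<open>(2 * n) ^ 2 < 2 ^ (z ^ 2)\<close>.\<close>
      define n where "n = k ^ s * z ^ 2"
      have nC: "2 * n \<le> C * z ^ a"
      proof -
        have "k ^ s \<le> (4 ^ D * z ^ D) ^ s" by (rule power_mono[OF k4]) simp
        also have "\<dots> = 4 ^ (D * s) * z ^ (D * s)" by (simp add: power_mult_distrib power_mult)
        finally have "2 * n \<le> 2 * (4 ^ (D * s) * z ^ (D * s)) * z ^ 2" by (simp add: n_def)
        also have "\<dots> = (2 * 4 ^ (D * s)) * z ^ a" by (simp add: a_def power_add power2_eq_square)
        also have "\<dots> \<le> C * z ^ a"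
        proof (rule mult_le_mono1)
          have "(4 :: nat) ^ (D * s) \<le> 4 ^ (D * r)" by (intro power_increasing) (simp_all add: r_def)
          then show "2 * 4 ^ (D * s) \<le> C"
            unfolding C_def by (intro mult_le_mono) (simp_all add: r_def)
        qed
        finally show ?thesis .
      qed
      obtain m where m: "prime m" "2 * k ^ s < m" "m \<le> 2 * n"
      proof (rule prime_between)
        show "n > 0" using z0 k2 by (simp add: n_def)
        have "(C * z ^ a) ^ 2 < 2 ^ z"
        proof -
          have "exp (ln 2 * real z) = 2 ^ z" by (metis exp_ln exp_of_nat2_mult mult.commute zero_less_numeral)
          then have "real ((C * z ^ a) ^ 2) < real (2 ^ z)" using elim(2) by (simp add: power_mult_distrib power_mult[symmetric] mult.commute)
          then show ?thesis by (simp only: of_nat_less_iff)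
        qed
        then have "(2 * n) ^ 2 < 2 ^ z" using power_mono[OF nC, of 2] by simp
        also have "(2 :: nat) ^ z \<le> 2 ^ (z ^ 2)" by (intro power_increasing) (simp_all add: power2_nat_le_imp_le self_le_power z0)
        finally have "((2 * n) ^ 2) ^ (k ^ s) < (2 ^ (z ^ 2)) ^ (k ^ s)"
          using k2 by (intro power_strict_mono) auto
        then have "(2 * n) ^ (2 * k ^ s) < 2 ^ (z ^ 2 * k ^ s)" by (simp only: power_mult)
        moreover have "z ^ 2 * k ^ s = n" by (simp add: n_def)
        ultimately show "(2 * n) ^ (2 * k ^ s) < 2 ^ n" by (simp only:)
      qed
      have mC: "m \<le> C * z ^ a" using m(3) nC by linarith
      have "k \<le> k ^ s" using s k2 by (simp add: self_le_power)
      then have km: "k \<le> m" using m(2) by simp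
      have rm: "r \<le> m" using rC CleC3 z_big zk km by linarith
      obtain F where F: "F \<subseteq> {..<(2 * z) ^ D}" "three_AP_free F" and cardF: "z ^ D \<le> card F * (D * z\<^sup>2 + 1)"
        using three_AP_free_dense[OF z0] by blast
      \<comment> \<open>Of the three powers of \<open>z\<close> given up, two pay for the density of
        \<open>F\<close> and one keeps \<open>p * l\<close> at least \<open>c * z\<close>. Since
        \<open>D\<close> is large compared with \<open>s\<close>, \<open>B ^ r\<close> still exceeds
        \<open>k * r * m * z\<close>.\<close>
      define B where "B = z ^ (D - 3)"
      have B: "B > 0" using z0 by (simp add: B_def)
      define l where "l = k div (r * t + 1)"
      have l: "(r * t + 1) * l \<le> k" unfolding l_def by (rule times_div_less_eq_dividend)
      have nm: "real (m * (k - 1) * m) \<le> real (C ^ 3) * real z ^ (2 * a + D)"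
      proof -
        have "m * (k - 1) * m \<le> (C * z ^ a) * (C * z ^ D) * (C * z ^ a)"
          using mC kC by (intro mult_le_mono) auto
        also have "\<dots> = C ^ 3 * z ^ (2 * a + D)" by (simp add: power_add power3_eq_cube mult_2 power2_eq_square)
        finally have "real (m * (k - 1) * m) \<le> real (C ^ 3 * z ^ (2 * a + D))" by (rule of_nat_mono)
        then show ?thesis by simp
      qed
      have first: "real (m * (k - 1) * m) * (real (r * t + 1) * (1 - real (card F) / real (B * (2 * (k - 1)))) ^ l) < 1 / 2"
      proof -
        define p where "p = real (card F) / real (B * (2 * (k - 1)))"
        have kpos: "real (k - 1) > 0" using k2 by simp
        have p0: "p \<ge> 0" by (simp add: p_def)
        have p1: "p \<le> 1"
        proof -
          have "card F \<le> (2 * z) ^ D" using card_mono[OF _ F(1)] by simp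
          also have "\<dots> \<le> 2 * (k - 1)" using k_lower by simp
          also have "\<dots> \<le> B * (2 * (k - 1))" using mult_le_mono1[of 1 B "2 * (k - 1)"] B by simp
          finally have "real (card F) \<le> real (B * (2 * (k - 1)))" by (rule of_nat_mono)
          then show ?thesis unfolding p_def using B kpos by (intro divide_le_eq_1_pos[THEN iffD2]) auto
        qed
        have p_lower: "real z ^ D \<le> p * (real D + 1) * 2 * 4 ^ D * real z ^ (2 * D - 1)"
        proof -
          have "D * z\<^sup>2 + 1 \<le> (D + 1) * z\<^sup>2" using z0 by simp
          then have "card F * (D * z\<^sup>2 + 1) \<le> card F * ((D + 1) * z\<^sup>2)" by (rule mult_le_mono2)
          then have "z ^ D \<le> card F * ((D + 1) * z\<^sup>2)" using cardF by linarith
          then have "real (z ^ D) \<le> real (card F * ((D + 1) * z\<^sup>2))" by (rule of_nat_mono)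
          then have "real z ^ D \<le> real (card F) * (real D + 1) * real z ^ 2" by (simp add: algebra_simps)
          also have "real (card F) = p * (real B * (2 * real (k - 1)))" using B kpos by (simp add: p_def)
          also have "p * (real B * (2 * real (k - 1))) * (real D + 1) * real z ^ 2 \<le>
              p * (real B * (2 * (4 ^ D * real z ^ D))) * (real D + 1) * real z ^ 2"
          proof -
            have "k - 1 \<le> 4 ^ D * z ^ D" using k4 by simp
            then have "real (k - 1) \<le> real (4 ^ D * z ^ D)" by (rule of_nat_mono)
            then have "real (k - 1) \<le> 4 ^ D * real z ^ D" by simp
            then show ?thesis using p0 by (intro mult_right_mono mult_left_mono) auto
          qed
          also have "\<dots> = p * (real D + 1) * 2 * 4 ^ D * (real z ^ (D - 3) * real z ^ D * real z ^ 2)"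
            by (simp add: B_def)
          also have "real z ^ (D - 3) * real z ^ D * real z ^ 2 = real z ^ (2 * D - 1)"
          proof -
            have "(D - 3) + D + 2 = 2 * D - 1" by (simp add: D_def)
            then show ?thesis by (metis power_add)
          qed
          finally show ?thesis .
        qed
        have l_lower: "real z ^ D \<le> 2 * real (r * t + 1) * real l"
        proof -
          have "z ^ D \<le> (2 * z) ^ D" by (intro power_mono) auto
          then have "z ^ D \<le> k" using k_lower by linarith
          also have kl: "k < (r * t + 1) * l + (r * t + 1)"
            unfolding l_def using dividend_less_times_div[of "r * t + 1" k] by simp
          finally have *: "z ^ D < (r * t + 1) * l + (r * t + 1)" .
          have "r * t + 1 \<le> (r * t + 1) * l"
          proof -
            have "r * t + 1 \<le> k" using z_big zk by linarith
            then have "l \<ge> 1" unfolding l_def by (simp add: div_greater_zero_iff Suc_le_eq)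
            then show ?thesis using mult_le_mono2[of 1 l "r * t + 1"] by (simp only: mult_1_right)
          qed
          with * have "z ^ D \<le> 2 * ((r * t + 1) * l)" by linarith
          then have "real (z ^ D) \<le> real (2 * ((r * t + 1) * l))" by (rule of_nat_mono)
          then show ?thesis by (simp only: of_nat_mult of_nat_power of_nat_numeral mult.assoc)
        qed
        \<comment> \<open>Multiplying \<open>p_lower\<close> and \<open>l_lower\<close> leaves
          exactly one power of \<open>z\<close> after cancelling
          \<open>z ^ (2 * D - 1)\<close>.\<close>
        have pl: "c * real z \<le> p * real l"
        proof -
          have "real z ^ D * real z ^ D \<le> (p * (real D + 1) * 2 * 4 ^ D * real z ^ (2 * D - 1)) * (2 * real (r * t + 1) * real l)"
            using p_lower l_lower p0 by (intro mult_mono) auto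
          moreover have "real z ^ D * real z ^ D = real z * real z ^ (2 * D - 1)"
          proof -
            have "Suc (2 * D - 1) = D + D" using D1 by simp
            then show ?thesis by (metis power_Suc power_add)
          qed
          moreover have "(p * d * 2 * q * Z) * (2 * M * L) = ((p * L) * (4 * d * q * M)) * Z" for d q Z M L :: real
            by simp
          ultimately have "real z * real z ^ (2 * D - 1) \<le> ((p * real l) * (4 * (real D + 1) * 4 ^ D * real (r * t + 1))) * real z ^ (2 * D - 1)"
            by (simp only:)
          then have "real z \<le> (p * real l) * (4 * (real D + 1) * 4 ^ D * real (r * t + 1))"
            using z0 by (simp only: mult_le_cancel_right) simp
          then show ?thesis unfolding c_def by (simp add: divide_le_eq add_pos_nonneg)
        qed
        have "(1 - p) ^ l \<le> exp (- p) ^ l"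
          using p1 exp_ge_add_one_self[of "- p"] by (intro power_mono) auto
        also have "\<dots> = exp (- (p * real l))" by (simp add: exp_of_nat_mult[symmetric] mult.commute)
        also have "\<dots> \<le> exp (- (c * real z))" using pl by simp
        finally have "(1 - p) ^ l \<le> exp (- (c * real z))" .
        then have "real (m * (k - 1) * m) * (real (r * t + 1) * (1 - p) ^ l) \<le>
          (real (C ^ 3) * real z ^ (2 * a + D)) * (real (r * t + 1) * exp (- (c * real z)))"
          using p1 by (intro mult_mono[OF nm] mult_left_mono) auto
        also have "\<dots> < 1 / 2"
          using elim(3) by (simp add: exp_minus field_simps)
        finally show ?thesis unfolding p_def .
      qed
      have second: "real (m * (k - 1) * m) * (real (k * r * m) ^ t * (1 / real B) ^ (r * t)) < 1 / 2"
      proof -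
        \<comment> \<open>The spare factor \<open>z\<close> is gained once for each of the
          \<open>t\<close> disjoint progressions, giving \<open>z ^ t\<close> in total.\<close>
        have "k * r * m * z \<le> B ^ r"
        proof -
          have "k * r * m * z \<le> (C * z ^ D) * C * (C * z ^ a) * z"
            using kC rC mC by (intro mult_le_mono) auto
          also have "\<dots> = C ^ 3 * z ^ (a + D + 1)" by (simp add: power_add power3_eq_cube)
          also have "\<dots> \<le> z * z ^ (a + D + 1)" using z_big by (intro mult_le_mono1) linarith
          also have "\<dots> = z ^ (a + D + 2)" by simp
          also have "\<dots> \<le> z ^ ((D - 3) * r)"
            using z0 by (intro power_increasing) (simp_all add: D_def a_def r_def algebra_simps)
          finally show ?thesis by (simp add: B_def power_mult)
        qed
        then have "real (k * r * m * z) \<le> real (B ^ r)" by (rule of_nat_mono)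
        then have "real (k * r * m) * (1 / real B) ^ r \<le> 1 / real z"
          using B z0 by (simp add: power_divide field_simps)
        then have "(real (k * r * m) * (1 / real B) ^ r) ^ t \<le> (1 / real z) ^ t"
          by (intro power_mono) auto
        then have "real (k * r * m) ^ t * (1 / real B) ^ (r * t) \<le> (1 / real z) ^ t"
          by (simp only: power_mult_distrib power_mult)
        then have "real (m * (k - 1) * m) * (real (k * r * m) ^ t * (1 / real B) ^ (r * t)) \<le>
          (real (C ^ 3) * real z ^ (2 * a + D)) * (1 / real z) ^ t"
          by (intro mult_mono[OF nm]) auto
        also have "\<dots> = real (C ^ 3) / real z"
          using z0 by (simp add: t_def power_divide)
        also have "\<dots> < 1 / 2"
        proof -
          have "real (2 * C ^ 3) < real z" using z_big by (simp only: of_nat_less_iff)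
          then show ?thesis using z0 by (simp add: field_simps)
        qed
        finally show ?thesis .
      qed
      have "F \<subseteq> {..<k - 1}" using F(1) k_lower by (auto dest!: subsetD)
      moreover have "real (m * (k - 1) * m) * (real (r * t + 1) * (1 - real (card F) / real (B * (2 * (k - 1)))) ^ l +
          real (k * r * m) ^ t * (1 / real B) ^ (r * t)) < 1"
        unfolding distrib_left using add_strict_mono[OF first second] by linarith
      ultimately have "m * (k - 1) < vdW r k"
        using s F(2) by (intro vdW_gt_if_union_bound[OF m(1) _ rm k2 km _ _ B l]) (simp_all add: r_def)
      \<comment> \<open>The factor 2 in \<open>2 * k ^ s < m\<close> compensates for
        \<open>k - 1\<close> in place of \<open>k\<close>.\<close>
      moreover have "k ^ (s + 1) \<le> m * (k - 1)"
      proof -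
        have "k ^ (s + 1) = k ^ s * k" by simp
        also have "\<dots> \<le> k ^ s * (2 * (k - 1))" using k2 by (intro mult_le_mono2) linarith
        also have "\<dots> = (2 * k ^ s) * (k - 1)" by simp
        also have "\<dots> \<le> m * (k - 1)" using m(2) by (intro mult_le_mono1) linarith
        finally show ?thesis .
      qed
      ultimately show "k ^ (s + 1) < vdW (s + 2) k" by (simp add: r_def)
    qed
  qed
qed

section \<open>From scales to all large \<open>k\<close>\<close>

text \<open>The largest \<open>z\<close> with \<open>(2 * z) ^ D < k\<close> works, because its
  successor fails. Thus the intervals of the scales cover all large \<open>k\<close>.\<close>

lemma scale_exists:
  fixes D k z0 :: nat
  assumes D: "D > 0" and k: "(2 * z0) ^ D < k"
  obtains z where "z \<ge> z0" "(2 * z) ^ D < k" "k \<le> (2 * z + 2) ^ D"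
proof -
  define P where "P z \<longleftrightarrow> (2 * z) ^ D < k" for z
  have bound: "z \<le> k" if "P z" for z
  proof -
    have "z \<le> (2 * z) ^ D" using D self_le_power[of "2 * z" D] by (cases "z = 0") auto
    then show ?thesis using that by (simp add: P_def)
  qed
  define z where "z = (GREATEST z. P z)"
  have P0: "P z0" using k by (simp add: P_def)
  have "P z" unfolding z_def by (rule GreatestI_nat[of P, OF P0]) (rule bound)
  moreover have "z \<ge> z0" unfolding z_def by (rule Greatest_le_nat[of P, OF P0]) (rule bound)
  moreover have "\<not> P (Suc z)"
    using Greatest_le_nat[of P "Suc z" k] bound unfolding z_def[symmetric] by auto
  ultimately show thesis by (intro that[of z]) (auto simp: P_def)
qed

theorem theorem2:
  fixes r :: nat
  assumes "r \<ge> 3"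
  shows "(\<lambda>k :: nat. real (vdW r k)) \<in> \<Omega>[at_top](\<lambda>k. real k ^ (r - 1) / ln (real k) ^ (r - 2))"
proof -
  define s where "s = r - 2"
  define D where "D = 12 * s + 24"
  have s: "s \<ge> 1" and r: "r = s + 2" using assms by (auto simp: s_def)
  obtain z0 where z0: "\<And>z k. \<lbrakk>z \<ge> z0; (2 * z) ^ D < k; k \<le> (2 * z + 2) ^ D\<rbrakk> \<Longrightarrow> k ^ (s + 1) < vdW (s + 2) k"
    using vdW_lower_bound_at_scale[OF s] unfolding eventually_sequentially D_def by blast
  \<comment> \<open>The constant 1 suffices, as \<open>k ^ (r - 1)\<close> itself is a lower bound
    and \<open>ln k \<ge> 1\<close> once \<open>k > 3\<close>. The other part of the threshold makes
    the scale at least \<open>z0\<close>.\<close>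
  have "\<forall>\<^sub>F k in at_top. 1 * norm (real k ^ (r - 1) / ln (real k) ^ (r - 2)) \<le> norm (real (vdW r k))"
    using eventually_gt_at_top[of "max 3 ((2 * z0) ^ D)"]
  proof eventually_elim
    case (elim k)
    obtain z where "z \<ge> z0" "(2 * z) ^ D < k" "k \<le> (2 * z + 2) ^ D"
      using scale_exists[of D z0 k] elim by (auto simp: D_def)
    then have "k ^ (s + 1) < vdW (s + 2) k" by (rule z0)
    then have "real (k ^ (r - 1)) \<le> real (vdW r k)" unfolding of_nat_le_iff r by simp
    then have *: "real k ^ (r - 1) \<le> real (vdW r k)" by (simp only: of_nat_power)
    have "exp 1 \<le> real k" using exp_le elim by simp
    then have ln: "1 \<le> ln (real k)" using elim by (subst ln_ge_iff) auto
    then have "real k ^ (r - 1) / ln (real k) ^ (r - 2) \<le> real k ^ (r - 1) / 1"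
      by (intro divide_left_mono) (auto intro: one_le_power)
    also have "\<dots> \<le> real (vdW r k)" using * by simp
    finally show ?case using ln by simp
  qed
  then show ?thesis by (intro landau_omega.bigI[of 1]) auto
qed

end
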